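(* The values $(U^*_{h,i})_{i=0,\dots,N-1}$ of the optimal sampled-data control $u^*_h=\sum_{i=0}^{N-1}U^*_{h,i}\,\mathbf{1}_{[s_i,s_{i+1})}$ are computed explicitly by the induction $$\begin{cases}U^*_{h,i}=-T_i^{-1}\big(P_iq_i+H_i\big),\\[3pt] q_{i+1}=Z(s_{i+1},s_i)q_i+\mathrm{ZB}_i\,U^*_{h,i}+\mathrm{Z}\Omega_i,\end{cases}\qquad i=0,\dots,N-1,$$ with the initial condition $q_0=q_a$. That is, if $(q_i)_{i=0,\dots,N}$ in $\mathbb{R}^n$ and $(U_i)_{i=0,\dots,N-1}$ in $\mathbb{R}^m$ are defined by $q_0=q_a$, $U_i=-T_i^{-1}(P_iq_i+H_i)$ and $q_{i+1}=Z(s_{i+1},s_i)q_i+\mathrm{ZB}_iU_i+\mathrm{Z}\Omega_i$, then $U_i=U^*_{h,i}$ for every $i=0,\dots,N-1$.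
   Context: Let $m,n\ge 1$ be integers and $a<b$ real numbers. Let $q_a,q_b\in\mathbb{R}^n$, let $S\in\mathbb{R}^{n\times n}$ be symmetric positive-semidefinite, let $x,\omega:[a,b]\to\mathbb{R}^n$ and $v:[a,b]\to\mathbb{R}^m$ be continuous, and let $A:[a,b]\to\mathbb{R}^{n\times n}$, $B:[a,b]\to\mathbb{R}^{n\times m}$, $W:[a,b]\to\mathbb{R}^{n\times n}$, $R:[a,b]\to\mathbb{R}^{m\times m}$ be continuous, with $W(t)$ symmetric positive-semidefinite and $R(t)$ symmetric positive-definite for every $t\in[a,b]$. For $u\in L^2([a,b],\mathbb{R}^m)$, let $q(\cdot,u)$ denote the unique absolutely continuous solution on $[a,b]$ of $\dot q(t)=A(t)q(t)+B(t)u(t)+\omega(t)$ for a.e. $t\in[a,b]$, $q(a)=q_a$. Define the cost $$C(u):=\tfrac12\langle S(q(b,u)-q_b),q(b,u)-q_b\rangle+\tfrac12\int_a^b\Big(\langle W(\tau)(q(\tau,u)-x(\tau)),q(\tau,u)-x(\tau)\rangle+\langle R(\tau)(u(\tau)-v(\tau)),u(\tau)-v(\tau)\rangle\Big)d\tau .$$ Fix $N\ge1$ and $h=(h_i)_{i=0,\dots,N-1}\in(0,+\infty)^N$ with $\sum_{i=0}^{N-1}h_i=b-a$, and set $s_i:=a+\sum_{j=0}^{i-1}h_j$ for $i=0,\dots,N$. Let $E_h$ be the set of functions $u:[a,b)\to\mathbb{R}^m$ constant on each $[s_i,s_{i+1})$, $i=0,\dots,N-1$. The optimal sampled-data control $u^*_h\in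 E_h$ is the unique minimizer of $C$ over $E_h$ (existence and uniqueness are standard), and $U^*_{h,i}\in\mathbb{R}^m$ denotes its value on $[s_i,s_{i+1})$. State-transition matrix: for $s\in[a,b]$, $Z(\cdot,s):[a,b]\to\mathbb{R}^{n\times n}$ is the solution of $\frac{d}{dt}Z(t,s)=A(t)Z(t,s)$, $Z(s,s)=\mathrm{Id}_n$. For $i=0,\dots,N-1$ and $\tau\in[s_i,s_{i+1}]$, abbreviate $\beta_i(\tau):=\int_{s_i}^\tau Z(\tau,s)B(s)\,ds\in\mathbb{R}^{n\times m}$ and $\gamma_i(\tau):=\int_{s_i}^\tau Z(\tau,s)\omega(s)\,ds-x(\tau)\in\mathbb{R}^n$, and define (multi-letter names are single symbols) - $\mathrm{ZB}_i:=\int_{s_i}^{s_{i+1}}Z(s_{i+1},s)B(s)\,ds\in\mathbb{R}^{n\times m}$; - $\mathrm{Z}\Omega_i:=\int_{s_i}^{s_{i+1}}Z(s_{i+1},s)\omega(s)\,ds\in\mathbb{R}^n$ if $0\le i\le N-2$, and $\mathrm{Z}\Omega_{N-1}:=\int_{s_{N-1}}^{s_N}Z(s_N,s)\omega(s)\,ds-q_b$; - $\mathrm{ZWZ}_i:=\int_{s_i}^{s_{i+1}}Z(\tau,s_i)^\top W(\tau)Z(\tau,s_i)\,d\tau\in\mathbb{R}^{n\times n}$; - $\mathrm{ZBWZ}_i:=\int_{s_i}^{s_{i+1}}\beta_i(\tau)^\top W(\tau)Z(\tau,s_i)\,d\tau\in\mathbb{R}^{m\times n}$; - $\mathrm{ZBWZB}_i:=\int_{s_i}^{s_{i+1}}\beta_i(\tau)^\top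 W(\tau)\beta_i(\tau)\,d\tau\in\mathbb{R}^{m\times m}$; - $\mathrm{ZBWZ}\Omega\mathrm{X}_i:=\int_{s_i}^{s_{i+1}}\beta_i(\tau)^\top W(\tau)\gamma_i(\tau)\,d\tau\in\mathbb{R}^m$; - $\mathrm{ZWZ}\Omega\mathrm{X}_i:=\int_{s_i}^{s_{i+1}}Z(\tau,s_i)^\top W(\tau)\gamma_i(\tau)\,d\tau\in\mathbb{R}^n$; - $\mathrm{R}_i:=\int_{s_i}^{s_{i+1}}R(s)\,ds\in\mathbb{R}^{m\times m}$, $\mathrm{RV}_i:=\int_{s_i}^{s_{i+1}}R(s)v(s)\,ds\in\mathbb{R}^m$. Define by backward recursion $K_N:=S$, $J_N:=0\in\mathbb{R}^n$ and, for $i=N-1,\dots,0$, $$G_i:=Z(s_{i+1},s_i)^\top K_{i+1}\mathrm{Z}\Omega_i+\mathrm{ZWZ}\Omega\mathrm{X}_i+Z(s_{i+1},s_i)^\top J_{i+1},$$ $$H_i:=\mathrm{ZB}_i^\top K_{i+1}\mathrm{Z}\Omega_i+\mathrm{ZBWZ}\Omega\mathrm{X}_i-\mathrm{RV}_i+\mathrm{ZB}_i^\top J_{i+1},$$ $$P_i:=\mathrm{ZB}_i^\top K_{i+1}Z(s_{i+1},s_i)+\mathrm{ZBWZ}_i,\qquad Q_i:=Z(s_{i+1},s_i)^\top K_{i+1}Z(s_{i+1},s_i)+\mathrm{ZWZ}_i,$$ $$T_i:=\mathrm{ZB}_i^\top K_{i+1}\mathrm{ZB}_i+\mathrm{ZBWZB}_i+\mathrm{R}_i,$$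 $$K_i:=Q_i-P_i^\top T_i^{-1}P_i,\qquad J_i:=G_i-P_i^\top T_i^{-1}H_i .$$ These sequences are well defined: each $K_{i+1}$ is positive-semidefinite, hence each $T_i$ is positive-definite and invertible. *)

theory Defs
  imports "HOL-Analysis.Analysis"
begin

section \<open>Matrices and absolutely continuous functions\<close>

definition sym_pos_semidef :: "real^'n^'n \<Rightarrow> bool" where
  "sym_pos_semidef M \<longleftrightarrow> transpose M = M \<and> (\<forall>y. 0 \<le> (M *v y) \<bullet> y)"

definition sym_pos_def :: "real^'n^'n \<Rightarrow> bool" where
  "sym_pos_def M \<longleftrightarrow> transpose M = M \<and> (\<forall>y. y \<noteq> 0 \<longrightarrow> 0 < (M *v y) \<bullet> y)"

text \<open>The library constant \<open>absolutely_continuous\<close> is about measures. Here is the usual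
  epsilon-delta notion for functions on a compact interval; the finite family of intervals
  \<open>(c i, d i)\<close>, \<open>i < k\<close>, has pairwise disjoint members.\<close>

definition abs_continuous_on :: "real \<Rightarrow> real \<Rightarrow> (real \<Rightarrow> 'a::real_normed_vector) \<Rightarrow> bool" where
  "abs_continuous_on a b f \<longleftrightarrow>
    (\<forall>\<epsilon>>0. \<exists>\<delta>>0. \<forall>(k::nat) c d.
       (\<forall>i<k. a \<le> c i \<and> c i \<le> d i \<and> d i \<le> b) \<longrightarrow>
       (\<forall>i<k. \<forall>j<k. i \<noteq> j \<longrightarrow> {c i<..<d i} \<inter> {c j<..<d j} = {}) \<longrightarrow>
       (\<Sum>i<k. d i - c i) < \<delta> \<longrightarrow>
       (\<Sum>i<k. norm (f (d i) - f (c i))) < \<epsilon>)"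


section \<open>The linear-quadratic problem\<close>

text \<open>In the notation of the control literature, the fields are
  \<open>a\<close>, \<open>b\<close>, \<open>q\<^sub>a\<close>, \<open>q\<^sub>b\<close>, \<open>S\<close>, \<open>x\<close>, \<open>\<omega>\<close>, \<open>v\<close>, \<open>A\<close>, \<open>B\<close>, \<open>W\<close>, \<open>R\<close>, \<open>N\<close> and \<open>h\<close>,
  in this order; the state space has dimension \<open>CARD('n)\<close> and the control space
  dimension \<open>CARD('m)\<close>.\<close>

record ('n::finite, 'm::finite) lq_data =
  t_start :: real
  t_end :: real
  q_start :: "real^'n"
  q_target :: "real^'n"
  S_mat :: "real^'n^'n"
  x_ref :: "real \<Rightarrow> real^'n"
  drift :: "real \<Rightarrow> real^'n"
  v_ref :: "real \<Rightarrow> real^'m"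
  A_mat :: "real \<Rightarrow> real^'n^'n"
  B_mat :: "real \<Rightarrow> real^'m^'n"
  W_mat :: "real \<Rightarrow> real^'n^'n"
  R_mat :: "real \<Rightarrow> real^'m^'m"
  n_steps :: nat
  step :: "nat \<Rightarrow> real"

text \<open>A function on \<open>[a,b]\<close> (on \<open>[a,b)\<close>) is a total function that is extensional, that is,
  equal to \<open>undefined\<close> outside that interval; this makes the uniqueness assertions behind the
  definite descriptions below meaningful.\<close>

definition is_trajectory ::
  "('n::finite, 'm::finite) lq_data \<Rightarrow> (real \<Rightarrow> real^'m) \<Rightarrow> (real \<Rightarrow> real^'n) \<Rightarrow> bool" where
  "is_trajectory D u q \<longleftrightarrow>
     q \<in> extensional {t_start D..t_end D} \<and>
     abs_continuous_on (t_start D) (t_end D) q \<and>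
     q (t_start D) = q_start D \<and>
     (AE t in lebesgue. t \<in> {t_start D..t_end D} \<longrightarrow>
        (q has_vector_derivative (A_mat D t *v q t + B_mat D t *v u t + drift D t))
          (at t within {t_start D..t_end D}))"

definition trajectory ::
  "('n::finite, 'm::finite) lq_data \<Rightarrow> (real \<Rightarrow> real^'m) \<Rightarrow> real \<Rightarrow> real^'n" where
  "trajectory D u = (THE q. is_trajectory D u q)"

definition cost :: "('n::finite, 'm::finite) lq_data \<Rightarrow> (real \<Rightarrow> real^'m) \<Rightarrow> real" where
  "cost D u =
     (let q = trajectory D u; a = t_start D; b = t_end D in
      1/2 * ((S_mat D *v (q b - q_target D)) \<bullet> (q b - q_target D)) +
      1/2 * integral {a..b} (\<lambda>\<tau>.
        (W_mat D \<tau> *v (q \<tau> - x_ref D \<tau>)) \<bullet> (q \<tau> - x_ref D \<tau>) +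
        (R_mat D \<tau> *v (u \<tau> - v_ref D \<tau>)) \<bullet> (u \<tau> - v_ref D \<tau>)))"

definition sample_time :: "('n::finite, 'm::finite) lq_data \<Rightarrow> nat \<Rightarrow> real" where
  "sample_time D i = t_start D + (\<Sum>j<i. step D j)"

definition sampled_controls :: "('n::finite, 'm::finite) lq_data \<Rightarrow> (real \<Rightarrow> real^'m) set" where
  "sampled_controls D =
     {u \<in> extensional {t_start D..<t_end D}.
        \<forall>i<n_steps D. \<exists>c. \<forall>t\<in>{sample_time D i..<sample_time D (Suc i)}. u t = c}"

definition optimal_sampled_control ::
  "('n::finite, 'm::finite) lq_data \<Rightarrow> real \<Rightarrow> real^'m" where
  "optimal_sampled_control D =
     (THE u. u \<in> sampled_controls D \<and> (\<forall>w\<in>sampled_controls D. cost D u \<le> cost D w))"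


section \<open>State-transition matrix and the integrals over a sampling interval\<close>

definition is_transition ::
  "('n::finite, 'm::finite) lq_data \<Rightarrow> real \<Rightarrow> (real \<Rightarrow> real^'n^'n) \<Rightarrow> bool" where
  "is_transition D s Y \<longleftrightarrow>
     Y \<in> extensional {t_start D..t_end D} \<and> Y s = mat 1 \<and>
     (\<forall>t\<in>{t_start D..t_end D}.
        (Y has_vector_derivative A_mat D t ** Y t) (at t within {t_start D..t_end D}))"

text \<open>\<open>Ztr D t s\<close> is \<open>Z(t,s)\<close>.\<close>

definition Ztr :: "('n::finite, 'm::finite) lq_data \<Rightarrow> real \<Rightarrow> real \<Rightarrow> real^'n^'n" where
  "Ztr D t s = (THE Y. is_transition D s Y) t"

abbreviation samp_interval :: "('n::finite, 'm::finite) lq_data \<Rightarrow> nat \<Rightarrow> real set" where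
  "samp_interval D i \<equiv> {sample_time D i..sample_time D (Suc i)}"

definition beta :: "('n::finite, 'm::finite) lq_data \<Rightarrow> nat \<Rightarrow> real \<Rightarrow> real^'m^'n" where
  "beta D i \<tau> = integral {sample_time D i..\<tau>} (\<lambda>s. Ztr D \<tau> s ** B_mat D s)"

definition gamma :: "('n::finite, 'm::finite) lq_data \<Rightarrow> nat \<Rightarrow> real \<Rightarrow> real^'n" where
  "gamma D i \<tau> = integral {sample_time D i..\<tau>} (\<lambda>s. Ztr D \<tau> s *v drift D s) - x_ref D \<tau>"

definition ZB :: "('n::finite, 'm::finite) lq_data \<Rightarrow> nat \<Rightarrow> real^'m^'n" where
  "ZB D i = integral (samp_interval D i) (\<lambda>s. Ztr D (sample_time D (Suc i)) s ** B_mat D s)"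

text \<open>The target state is subtracted at the last index only, so that the last state produced by
  the recursion is \<open>q(b) - q\<^sub>b\<close>.\<close>

definition Z\<Omega> :: "('n::finite, 'm::finite) lq_data \<Rightarrow> nat \<Rightarrow> real^'n" where
  "Z\<Omega> D i =
     integral (samp_interval D i) (\<lambda>s. Ztr D (sample_time D (Suc i)) s *v drift D s)
     - (if Suc i = n_steps D then q_target D else 0)"

definition ZWZ :: "('n::finite, 'm::finite) lq_data \<Rightarrow> nat \<Rightarrow> real^'n^'n" where
  "ZWZ D i = integral (samp_interval D i)
     (\<lambda>\<tau>. transpose (Ztr D \<tau> (sample_time D i)) ** W_mat D \<tau> ** Ztr D \<tau> (sample_time D i))"

definition ZBWZ :: "('n::finite, 'm::finite) lq_data \<Rightarrow> nat \<Rightarrow> real^'n^'m" where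
  "ZBWZ D i = integral (samp_interval D i)
     (\<lambda>\<tau>. transpose (beta D i \<tau>) ** W_mat D \<tau> ** Ztr D \<tau> (sample_time D i))"

definition ZBWZB :: "('n::finite, 'm::finite) lq_data \<Rightarrow> nat \<Rightarrow> real^'m^'m" where
  "ZBWZB D i = integral (samp_interval D i)
     (\<lambda>\<tau>. transpose (beta D i \<tau>) ** W_mat D \<tau> ** beta D i \<tau>)"

definition ZBWZ\<Omega>X :: "('n::finite, 'm::finite) lq_data \<Rightarrow> nat \<Rightarrow> real^'m" where
  "ZBWZ\<Omega>X D i = integral (samp_interval D i)
     (\<lambda>\<tau>. (transpose (beta D i \<tau>) ** W_mat D \<tau>) *v gamma D i \<tau>)"

definition ZWZ\<Omega>X :: "('n::finite, 'm::finite) lq_data \<Rightarrow> nat \<Rightarrow> real^'n" where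
  "ZWZ\<Omega>X D i = integral (samp_interval D i)
     (\<lambda>\<tau>. (transpose (Ztr D \<tau> (sample_time D i)) ** W_mat D \<tau>) *v gamma D i \<tau>)"

definition R_int :: "('n::finite, 'm::finite) lq_data \<Rightarrow> nat \<Rightarrow> real^'m^'m" where
  "R_int D i = integral (samp_interval D i) (R_mat D)"

definition RV :: "('n::finite, 'm::finite) lq_data \<Rightarrow> nat \<Rightarrow> real^'m" where
  "RV D i = integral (samp_interval D i) (\<lambda>s. R_mat D s *v v_ref D s)"

abbreviation Zstep :: "('n::finite, 'm::finite) lq_data \<Rightarrow> nat \<Rightarrow> real^'n^'n" where
  "Zstep D i \<equiv> Ztr D (sample_time D (Suc i)) (sample_time D i)"


section \<open>The backward recursion\<close>

text \<open>In the next five definitions the arguments \<open>K'\<close> and \<open>J'\<close> stand for the terms of the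
  sequences \<open>K\<close> and \<open>J\<close> at index \<open>i + 1\<close>.\<close>

definition P_of :: "('n::finite, 'm::finite) lq_data \<Rightarrow> real^'n^'n \<Rightarrow> nat \<Rightarrow> real^'n^'m" where
  "P_of D K' i = transpose (ZB D i) ** K' ** Zstep D i + ZBWZ D i"

definition Q_of :: "('n::finite, 'm::finite) lq_data \<Rightarrow> real^'n^'n \<Rightarrow> nat \<Rightarrow> real^'n^'n" where
  "Q_of D K' i = transpose (Zstep D i) ** K' ** Zstep D i + ZWZ D i"

definition T_of :: "('n::finite, 'm::finite) lq_data \<Rightarrow> real^'n^'n \<Rightarrow> nat \<Rightarrow> real^'m^'m" where
  "T_of D K' i = transpose (ZB D i) ** K' ** ZB D i + ZBWZB D i + R_int D i"

definition G_of ::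
  "('n::finite, 'm::finite) lq_data \<Rightarrow> real^'n^'n \<Rightarrow> real^'n \<Rightarrow> nat \<Rightarrow> real^'n" where
  "G_of D K' J' i =
     (transpose (Zstep D i) ** K') *v Z\<Omega> D i + ZWZ\<Omega>X D i + transpose (Zstep D i) *v J'"

definition H_of ::
  "('n::finite, 'm::finite) lq_data \<Rightarrow> real^'n^'n \<Rightarrow> real^'n \<Rightarrow> nat \<Rightarrow> real^'m" where
  "H_of D K' J' i =
     (transpose (ZB D i) ** K') *v Z\<Omega> D i + ZBWZ\<Omega>X D i - RV D i + transpose (ZB D i) *v J'"

function K_seq :: "('n::finite, 'm::finite) lq_data \<Rightarrow> nat \<Rightarrow> real^'n^'n" where
  "K_seq D i =
     (if i < n_steps D then
        let K' = K_seq D (Suc i); P = P_of D K' i in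
        Q_of D K' i - transpose P ** matrix_inv (T_of D K' i) ** P
      else S_mat D)"
  by pat_completeness auto
termination by (relation "Wellfounded.measure (\<lambda>(D, i). n_steps D - i)") auto

declare K_seq.simps [simp del]

function J_seq :: "('n::finite, 'm::finite) lq_data \<Rightarrow> nat \<Rightarrow> real^'n" where
  "J_seq D i =
     (if i < n_steps D then
        let K' = K_seq D (Suc i); J' = J_seq D (Suc i) in
        G_of D K' J' i
        - (transpose (P_of D K' i) ** matrix_inv (T_of D K' i)) *v H_of D K' J' i
      else 0)"
  by pat_completeness auto
termination by (relation "Wellfounded.measure (\<lambda>(D, i). n_steps D - i)") auto

declare J_seq.simps [simp del]

definition P_seq :: "('n::finite, 'm::finite) lq_data \<Rightarrow> nat \<Rightarrow> real^'n^'m" where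
  "P_seq D i = P_of D (K_seq D (Suc i)) i"

definition T_seq :: "('n::finite, 'm::finite) lq_data \<Rightarrow> nat \<Rightarrow> real^'m^'m" where
  "T_seq D i = T_of D (K_seq D (Suc i)) i"

definition H_seq :: "('n::finite, 'm::finite) lq_data \<Rightarrow> nat \<Rightarrow> real^'m" where
  "H_seq D i = H_of D (K_seq D (Suc i)) (J_seq D (Suc i)) i"

end

theory Submission
  imports Defs
begin

text \<open>On a sampling interval, variation of constants turns the dynamics into an affine recursion for
  the sampled states and the running cost into a quadratic function of the state and the control
  value at the left endpoint. Adding the value function \<open>\<langle>K y, y\<rangle> + 2 \<langle>J, y\<rangle>\<close> at index
  \<open>i + 1\<close> and completing the square in the control value reproduces the value function at index
  \<open>i\<close>, up to a constant and the gap \<open>\<langle>T d, d\<rangle>\<close>, where \<open>d\<close> is the difference between the control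
  value and the feedback law. Summing up, twice the cost is a constant plus the sum of the gaps;
  since the matrices \<open>T\<close> are positive definite, it is minimal exactly when all gaps vanish.\<close>

section \<open>Matrix algebra\<close>

text \<open>\<open>trajectory\<close>, \<open>Ztr\<close> and \<open>optimal_sampled_control\<close>
  are definite descriptions, so nothing can be said about them before existence and uniqueness are
  proved; this accounts for the analytic half of the development. The delicate point is uniqueness
  of trajectories: an absolutely continuous solution satisfies its equation only almost everywhere,
  and integrating that equation takes the fundamental theorem of calculus for absolutely continuous
  functions. Explicit formulas rest on the factorization \<open>Z t s = Phi t ** Psi s\<close>,
  which frees the integrands of \<open>beta\<close> and \<open>gamma\<close> from the upper limit of
  integration. The cost formula is an exact identity, not an estimate, so it yields existence of the
  minimizer, its uniqueness and its values at once, without compactness or convexity arguments: each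
  gap is measured at the state that the control itself generates, hence the vanishing of all gaps is
  a forward recursion with a single solution.\<close>

lemma bounded_bilinear_matrix_matrix_mult:
  "bounded_bilinear ((**) :: real^'k^'m \<Rightarrow> real^'n^'k \<Rightarrow> real^'n^'m)"
  unfolding bilinear_conv_bounded_bilinear[symmetric] bilinear_def
  by (auto intro!: linearI simp: matrix_matrix_mult_def vec_eq_iff sum.distrib algebra_simps
      sum_distrib_left)

lemma bounded_bilinear_matrix_vector_mult:
  "bounded_bilinear ((*v) :: real^'n^'m \<Rightarrow> real^'n \<Rightarrow> real^'m)"
  unfolding bilinear_conv_bounded_bilinear[symmetric] bilinear_def
  by (auto intro!: linearI simp: matrix_vector_mult_def vec_eq_iff sum.distrib algebra_simps
      sum_distrib_left)

lemma bounded_linear_transpose: "bounded_linear (transpose :: real^'n^'m \<Rightarrow> real^'m^'n)"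
  unfolding linear_conv_bounded_linear[symmetric]
  by (auto intro!: linearI simp: transpose_def vec_eq_iff)

lemmas continuous_on_matrix_mult [continuous_intros] =
  bounded_bilinear.continuous_on[OF bounded_bilinear_matrix_matrix_mult]

lemmas continuous_on_matrix_vector_mult [continuous_intros] =
  bounded_bilinear.continuous_on[OF bounded_bilinear_matrix_vector_mult]

lemmas continuous_on_transpose [continuous_intros] =
  bounded_linear.continuous_on[OF bounded_linear_transpose]

lemma inner_transpose_matrix: "(transpose M *v x) \<bullet> y = x \<bullet> (M *v y)"
  for M :: "real^'n^'m"
  by (metis dot_lmul_matrix transpose_matrix_vector)

lemma inner_transpose_matrix_right: "y \<bullet> (transpose M *v x) = (M *v y) \<bullet> x"
  for M :: "real^'n^'m"
  by (metis inner_commute inner_transpose_matrix)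

lemma inner_symmetric_matrix:
  fixes M :: "real^'n^'n"
  assumes "transpose M = M"
  shows "(M *v x) \<bullet> y = (M *v y) \<bullet> x"
  by (metis assms inner_commute inner_transpose_matrix)

lemma sym_pos_def_invertible:
  assumes "sym_pos_def M"
  shows "invertible M"
proof -
  have "x = 0" if "M *v x = 0" for x
    using assms that by (metis inner_zero_left less_irrefl sym_pos_def_def)
  then show ?thesis
    by (simp add: invertible_left_inverse matrix_left_invertible_ker)
qed

text \<open>Symmetry of \<open>W t\<close> merges the cross terms in pairs, and the fixed vectors
  \<open>x\<close> and \<open>w\<close> move out of the integrals by linearity. It serves three
  times: for the state cost, for the control cost (identity matrices and
  \<open>\<gamma> = - v_ref D\<close>), and with \<open>\<gamma> = 0\<close> for the purely
  quadratic part.\<close>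

lemma integral_matrix_quadratic:
  fixes Z :: "real \<Rightarrow> real^'n^'k" and \<beta> :: "real \<Rightarrow> real^'m^'k" and \<gamma> :: "real \<Rightarrow> real^'k"
  assumes W: "continuous_on {c..d} W" and Z: "continuous_on {c..d} Z"
    and \<beta>: "continuous_on {c..d} \<beta>" and \<gamma>: "continuous_on {c..d} \<gamma>"
    and sym: "\<And>t. t \<in> {c..d} \<Longrightarrow> transpose (W t) = W t"
  shows "((\<lambda>t. (W t *v (Z t *v x + \<beta> t *v w + \<gamma> t)) \<bullet> (Z t *v x + \<beta> t *v w + \<gamma> t)) has_integral
     (integral {c..d} (\<lambda>t. transpose (Z t) ** W t ** Z t) *v x) \<bullet> x
     + 2 * ((integral {c..d} (\<lambda>t. transpose (\<beta> t) ** W t ** Z t) *v x) \<bullet> w)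
     + (integral {c..d} (\<lambda>t. transpose (\<beta> t) ** W t ** \<beta> t) *v w) \<bullet> w
     + 2 * (integral {c..d} (\<lambda>t. (transpose (\<beta> t) ** W t) *v \<gamma> t) \<bullet> w)
     + 2 * (integral {c..d} (\<lambda>t. (transpose (Z t) ** W t) *v \<gamma> t) \<bullet> x)
     + integral {c..d} (\<lambda>t. (W t *v \<gamma> t) \<bullet> \<gamma> t)) {c..d}"
proof (rule has_integral_eq)
  let ?f = "\<lambda>t. ((transpose (Z t) ** W t ** Z t) *v x) \<bullet> x
     + 2 * (((transpose (\<beta> t) ** W t ** Z t) *v x) \<bullet> w)
     + ((transpose (\<beta> t) ** W t ** \<beta> t) *v w) \<bullet> w
     + 2 * (((transpose (\<beta> t) ** W t) *v \<gamma> t) \<bullet> w)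
     + 2 * (((transpose (Z t) ** W t) *v \<gamma> t) \<bullet> x)
     + (W t *v \<gamma> t) \<bullet> \<gamma> t"
  fix t assume t: "t \<in> {c..d}"
  note s = inner_symmetric_matrix[OF sym[OF t]]
  show "?f t = (W t *v (Z t *v x + \<beta> t *v w + \<gamma> t)) \<bullet> (Z t *v x + \<beta> t *v w + \<gamma> t)"
    using s[of "Z t *v x" "\<beta> t *v w"] s[of "Z t *v x" "\<gamma> t"] s[of "\<beta> t *v w" "\<gamma> t"]
    by (simp add: matrix_vector_mul_assoc[symmetric] inner_transpose_matrix inner_transpose_matrix_right
        matrix_vector_right_distrib inner_add_left inner_add_right inner_commute algebra_simps
        del: transpose_matrix_vector)
next
  have mv: "((\<lambda>t. (M t *v y) \<bullet> z) has_integral (integral {c..d} M *v y) \<bullet> z) {c..d}"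
    if "continuous_on {c..d} M" for M :: "real \<Rightarrow> real^'i^'j" and y z
    using has_integral_linear[OF integrable_integral[OF integrable_continuous_real[OF that]],
        OF bounded_linear_compose[OF bounded_linear_inner_left
          bounded_bilinear.bounded_linear_left[OF bounded_bilinear_matrix_vector_mult]], of y z]
    by (simp add: o_def)
  have vv: "((\<lambda>t. f t \<bullet> z) has_integral integral {c..d} f \<bullet> z) {c..d}"
    if "continuous_on {c..d} f" for f :: "real \<Rightarrow> real^'i" and z
    using has_integral_linear[OF integrable_integral[OF integrable_continuous_real[OF that]]
        bounded_linear_inner_left, of z]
    by (simp add: o_def)
  show "((\<lambda>t. ((transpose (Z t) ** W t ** Z t) *v x) \<bullet> x
     + 2 * (((transpose (\<beta> t) ** W t ** Z t) *v x) \<bullet> w)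
     + ((transpose (\<beta> t) ** W t ** \<beta> t) *v w) \<bullet> w
     + 2 * (((transpose (\<beta> t) ** W t) *v \<gamma> t) \<bullet> w)
     + 2 * (((transpose (Z t) ** W t) *v \<gamma> t) \<bullet> x)
     + (W t *v \<gamma> t) \<bullet> \<gamma> t) has_integral
     (integral {c..d} (\<lambda>t. transpose (Z t) ** W t ** Z t) *v x) \<bullet> x
     + 2 * ((integral {c..d} (\<lambda>t. transpose (\<beta> t) ** W t ** Z t) *v x) \<bullet> w)
     + (integral {c..d} (\<lambda>t. transpose (\<beta> t) ** W t ** \<beta> t) *v w) \<bullet> w
     + 2 * (integral {c..d} (\<lambda>t. (transpose (\<beta> t) ** W t) *v \<gamma> t) \<bullet> w)
     + 2 * (integral {c..d} (\<lambda>t. (transpose (Z t) ** W t) *v \<gamma> t) \<bullet> x)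
     + integral {c..d} (\<lambda>t. (W t *v \<gamma> t) \<bullet> \<gamma> t)) {c..d}"
    by (intro has_integral_add has_integral_mult_right mv vv integrable_integral
        integrable_continuous_real continuous_intros W Z \<beta> \<gamma>)
qed

lemma transpose_integral:
  fixes M :: "real \<Rightarrow> real^'n^'m"
  assumes "continuous_on {c..d} M"
  shows "transpose (integral {c..d} M) = integral {c..d} (\<lambda>t. transpose (M t))"
  using integral_linear[OF integrable_continuous_real[OF assms] bounded_linear_transpose]
  by (simp add: o_def)

lemma transpose_congruence:
  fixes W :: "real^'k^'k" and Z :: "real^'n^'k"
  assumes "transpose W = W"
  shows "transpose (transpose Z ** W ** Z) = transpose Z ** W ** Z"
  by (simp add: matrix_transpose_mul assms matrix_mul_assoc)

lemma transpose_add: "transpose (X + Y) = transpose X + transpose Y" for X Y :: "real^'n^'m"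
  by (simp add: transpose_def vec_eq_iff)

lemma transpose_diff: "transpose (X - Y) = transpose X - transpose Y" for X Y :: "real^'n^'m"
  by (simp add: transpose_def vec_eq_iff)

lemma matrix_inv_mult:
  fixes T :: "real^'n^'n"
  assumes "invertible T"
  shows "T ** matrix_inv T = mat 1" "matrix_inv T ** T = mat 1"
  using someI_ex[OF assms[unfolded invertible_def]] by (simp_all add: matrix_inv_def)

lemma transpose_matrix_inv:
  fixes T :: "real^'n^'n"
  assumes "transpose T = T" "invertible T"
  shows "transpose (matrix_inv T) = matrix_inv T"
proof -
  have "transpose (matrix_inv T) ** T = mat 1"
    using matrix_inv_mult(1)[OF assms(2)] by (metis assms(1) matrix_transpose_mul transpose_mat)
  then show ?thesis
    by (metis assms(2) matrix_inv_mult(1) matrix_mul_assoc matrix_mul_lid matrix_mul_rid)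
qed

text \<open>\<open>\<mu>\<close> is the stationary point in \<open>w\<close>, that is
  \<open>T *v \<mu> = - (P *v x + H)\<close>. The value there contains minus the form of
  \<open>matrix_inv T\<close> at \<open>P *v x + H\<close>; its quadratic, linear and constant parts
  in \<open>x\<close> are the corrections to \<open>Q\<close>, to \<open>G\<close> and to the
  constant. With \<open>Q_of\<close> and \<open>G_of\<close> in these roles the new coefficients are
  those of \<open>K_seq\<close> and \<open>J_seq\<close>.\<close>

lemma completing_square:
  fixes T :: "real^'m^'m" and P :: "real^'n^'m" and x :: "real^'n" and H :: "real^'m"
  assumes sym: "transpose T = T" and inv: "invertible T"
  defines "\<mu> \<equiv> - (matrix_inv T *v (P *v x + H))"
  shows "(Q *v x) \<bullet> x + 2 * ((P *v x) \<bullet> w) + (T *v w) \<bullet> w + 2 * (H \<bullet> w) + 2 * (G \<bullet> x)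
    = ((Q - transpose P ** matrix_inv T ** P) *v x) \<bullet> x
      + 2 * ((G - (transpose P ** matrix_inv T) *v H) \<bullet> x)
      + (T *v (w - \<mu>)) \<bullet> (w - \<mu>) - (matrix_inv T *v H) \<bullet> H"
proof -
  let ?r = "P *v x + H"
  have T\<mu>: "T *v \<mu> = - ?r"
    unfolding \<mu>_def by (simp add: matrix_vector_mul_assoc matrix_inv_mult[OF inv]
        linear_neg[OF matrix_vector_mul_linear])
  have "(T *v (w - \<mu>)) \<bullet> (w - \<mu>) = (T *v w) \<bullet> w - 2 * ((T *v \<mu>) \<bullet> w) + (T *v \<mu>) \<bullet> \<mu>"
    using inner_symmetric_matrix[OF sym, of w \<mu>]
    by (simp add: matrix_vector_mult_diff_distrib inner_diff_left inner_diff_right)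
  also have "\<dots> = (T *v w) \<bullet> w + 2 * (?r \<bullet> w) + ?r \<bullet> (matrix_inv T *v ?r)"
    unfolding T\<mu> by (simp add: \<mu>_def inner_diff_left inner_add_left)
  also have "?r \<bullet> (matrix_inv T *v ?r) = (P *v x) \<bullet> (matrix_inv T *v (P *v x))
      + 2 * ((P *v x) \<bullet> (matrix_inv T *v H)) + H \<bullet> (matrix_inv T *v H)"
    using inner_symmetric_matrix[OF transpose_matrix_inv[OF sym inv], of H "P *v x"]
    by (simp add: matrix_vector_right_distrib inner_add_left inner_add_right inner_commute)
  finally show ?thesis
    by (simp add: matrix_vector_mult_diff_rdistrib inner_diff_left inner_add_left
        matrix_vector_mul_assoc[symmetric] inner_transpose_matrix inner_transpose_matrix_right inner_commute algebra_simps
        del: transpose_matrix_vector)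
qed

text \<open>Pulls a value function back along one affine step of the dynamics. The terms are grouped
  exactly as in \<open>Q_of\<close>, \<open>P_of\<close>, \<open>T_of\<close>, \<open>H_of\<close>
  and \<open>G_of\<close>, apart from the contributions of the running cost.\<close>

lemma quadratic_substitution:
  fixes K :: "real^'n^'n" and Z :: "real^'n^'n" and B :: "real^'m^'n"
  assumes sym: "transpose K = K"
  shows "(K *v (Z *v x + B *v w + \<omega>)) \<bullet> (Z *v x + B *v w + \<omega>) + 2 * (J \<bullet> (Z *v x + B *v w + \<omega>))
    = ((transpose Z ** K ** Z) *v x) \<bullet> x + 2 * (((transpose B ** K ** Z) *v x) \<bullet> w)
      + ((transpose B ** K ** B) *v w) \<bullet> w
      + 2 * (((transpose B ** K) *v \<omega> + transpose B *v J) \<bullet> w)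
      + 2 * (((transpose Z ** K) *v \<omega> + transpose Z *v J) \<bullet> x)
      + ((K *v \<omega>) \<bullet> \<omega> + 2 * (J \<bullet> \<omega>))"
  using inner_symmetric_matrix[OF sym, of "Z *v x" "B *v w"]
    inner_symmetric_matrix[OF sym, of "Z *v x" \<omega>] inner_symmetric_matrix[OF sym, of "B *v w" \<omega>]
  by (simp add: matrix_vector_mul_assoc[symmetric] inner_transpose_matrix inner_transpose_matrix_right
      matrix_vector_right_distrib inner_add_left inner_add_right inner_commute algebra_simps
      del: transpose_matrix_vector)

section \<open>Absolutely continuous functions\<close>

text \<open>The definition enumerates its intervals by an initial segment of the naturals. Free
  index sets allow the tagged pieces of a division to index themselves; a bijection with
  \<open>{..<card I}\<close> transfers the property.\<close>

lemma abs_continuous_on_finite: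
  assumes ac: "abs_continuous_on a b f" and e: "\<epsilon> > 0"
  shows "\<exists>\<delta>>0. \<forall>(I :: 'i set) c d. finite I \<longrightarrow> (\<forall>i\<in>I. a \<le> c i \<and> c i \<le> d i \<and> d i \<le> b)
      \<longrightarrow> pairwise (\<lambda>i j. disjnt {c i<..<d i} {c j<..<d j}) I \<longrightarrow> (\<Sum>i\<in>I. d i - c i) < \<delta>
      \<longrightarrow> (\<Sum>i\<in>I. norm (f (d i) - f (c i))) < \<epsilon>"
proof -
  obtain \<delta> where d: "\<delta> > 0" and *: "\<forall>(k::nat) c d.
       (\<forall>i<k. a \<le> c i \<and> c i \<le> d i \<and> d i \<le> b) \<longrightarrow>
       (\<forall>i<k. \<forall>j<k. i \<noteq> j \<longrightarrow> {c i<..<d i} \<inter> {c j<..<d j} = {}) \<longrightarrow>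
       (\<Sum>i<k. d i - c i) < \<delta> \<longrightarrow> (\<Sum>i<k. norm (f (d i) - f (c i))) < \<epsilon>"
    using ac[unfolded abs_continuous_on_def, rule_format, OF e] by blast
  show ?thesis
  proof (intro exI[of _ \<delta>] conjI d allI impI)
    fix I :: "'i set" and c d
    assume fin: "finite I" and cd: "\<forall>i\<in>I. a \<le> c i \<and> c i \<le> d i \<and> d i \<le> b"
      and dis: "pairwise (\<lambda>i j. disjnt {c i<..<d i} {c j<..<d j}) I"
      and sm: "(\<Sum>i\<in>I. d i - c i) < \<delta>"
    obtain h where h: "bij_betw h {..<card I} I"
      using ex_bij_betw_nat_finite[OF fin] by (auto simp: atLeast0LessThan)
    have "(\<Sum>k<card I. norm (f ((d \<circ> h) k) - f ((c \<circ> h) k))) < \<epsilon>"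
    proof (rule *[rule_format])
      show "a \<le> (c \<circ> h) i \<and> (c \<circ> h) i \<le> (d \<circ> h) i \<and> (d \<circ> h) i \<le> b" if "i < card I" for i
        using cd bij_betwE[OF h] that by auto
      fix i j assume ij: "i < card I" "j < card I" "i \<noteq> j"
      then have "h i \<in> I" "h j \<in> I" "h i \<noteq> h j"
        using h unfolding bij_betw_def inj_on_def by auto
      with dis show "{(c \<circ> h) i<..<(d \<circ> h) i} \<inter> {(c \<circ> h) j<..<(d \<circ> h) j} = {}"
        unfolding pairwise_def disjnt_def by simp
    next
      show "(\<Sum>i<card I. (d \<circ> h) i - (c \<circ> h) i) < \<delta>"
        using sum.reindex_bij_betw[OF h, of "\<lambda>i. d i - c i"] sm by simp
    qed
    then show "(\<Sum>i\<in>I. norm (f (d i) - f (c i))) < \<epsilon>"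
      using sum.reindex_bij_betw[OF h, of "\<lambda>i. norm (f (d i) - f (c i))"] by simp
  qed
qed

lemma abs_continuous_on_subset:
  assumes "abs_continuous_on a b f" "a \<le> a'" "b' \<le> b"
  shows "abs_continuous_on a' b' f"
  unfolding abs_continuous_on_def
proof (intro allI impI)
  fix \<epsilon> :: real assume e: "\<epsilon> > 0"
  obtain \<delta> where d: "\<delta> > 0" and *: "\<forall>(k::nat) c d.
       (\<forall>i<k. a \<le> c i \<and> c i \<le> d i \<and> d i \<le> b) \<longrightarrow>
       (\<forall>i<k. \<forall>j<k. i \<noteq> j \<longrightarrow> {c i<..<d i} \<inter> {c j<..<d j} = {}) \<longrightarrow>
       (\<Sum>i<k. d i - c i) < \<delta> \<longrightarrow> (\<Sum>i<k. norm (f (d i) - f (c i))) < \<epsilon>"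
    using assms(1)[unfolded abs_continuous_on_def, rule_format, OF e] by blast
  show "\<exists>\<delta>>0. \<forall>(k::nat) c d.
       (\<forall>i<k. a' \<le> c i \<and> c i \<le> d i \<and> d i \<le> b') \<longrightarrow>
       (\<forall>i<k. \<forall>j<k. i \<noteq> j \<longrightarrow> {c i<..<d i} \<inter> {c j<..<d j} = {}) \<longrightarrow>
       (\<Sum>i<k. d i - c i) < \<delta> \<longrightarrow> (\<Sum>i<k. norm (f (d i) - f (c i))) < \<epsilon>"
  proof (intro exI[of _ \<delta>] conjI d allI impI)
    fix k :: nat and c d :: "nat \<Rightarrow> real"
    assume cd: "\<forall>i<k. a' \<le> c i \<and> c i \<le> d i \<and> d i \<le> b'"
      and "\<forall>i<k. \<forall>j<k. i \<noteq> j \<longrightarrow> {c i<..<d i} \<inter> {c j<..<d j} = {}" "(\<Sum>i<k. d i - c i) < \<delta>"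
    moreover have "\<forall>i<k. a \<le> c i \<and> c i \<le> d i \<and> d i \<le> b"
      using cd assms by force
    ultimately show "(\<Sum>i<k. norm (f (d i) - f (c i))) < \<epsilon>" using * by blast
  qed
qed

lemma abs_continuous_on_imp_continuous_on:
  assumes "abs_continuous_on a b f"
  shows "continuous_on {a..b} f"
  unfolding continuous_on_iff
proof (intro ballI allI impI)
  fix x and e :: real assume x: "x \<in> {a..b}" and e: "e > 0"
  obtain \<delta> where d: "\<delta> > 0" and *: "\<forall>(I :: unit set) c d. finite I \<longrightarrow>
      (\<forall>i\<in>I. a \<le> c i \<and> c i \<le> d i \<and> d i \<le> b)
      \<longrightarrow> pairwise (\<lambda>i j. disjnt {c i<..<d i} {c j<..<d j}) I \<longrightarrow> (\<Sum>i\<in>I. d i - c i) < \<delta>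
      \<longrightarrow> (\<Sum>i\<in>I. norm (f (d i) - f (c i))) < e"
    using abs_continuous_on_finite[OF assms e] by blast
  show "\<exists>d>0. \<forall>x'\<in>{a..b}. dist x' x < d \<longrightarrow> dist (f x') (f x) < e"
  proof (intro exI[of _ \<delta>] conjI d ballI impI)
    fix y assume y: "y \<in> {a..b}" "dist y x < \<delta>"
    \<comment> \<open>A family with one interval; taking minimum and maximum as endpoints treats
      both orders of \<open>x\<close> and \<open>y\<close> together.\<close>
    have "(\<Sum>i\<in>{()}. norm (f (max x y) - f (min x y))) < e"
      by (rule *[rule_format, of "{()}" "\<lambda>_. min x y" "\<lambda>_. max x y"])
        (use x y in \<open>auto simp: dist_real_def\<close>)
    then show "dist (f y) (f x) < e"
      by (auto simp: dist_norm max_def min_def norm_minus_commute split: if_splits)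
  qed
qed

text \<open>Cover the exceptional null set \<open>N\<close> by an open set of small measure and choose a gauge that
  keeps the pieces with tags in \<open>N\<close> inside it: these contribute little by absolute continuity, the
  others by differentiability.\<close>

theorem has_integral_abs_continuous_on:
  fixes f :: "real \<Rightarrow> 'a::banach"
  assumes ab: "a \<le> b" and ac: "abs_continuous_on a b f"
    and ae: "AE t in lebesgue. t \<in> {a..b} \<longrightarrow> (f has_vector_derivative f' t) (at t within {a..b})"
  shows "(f' has_integral (f b - f a)) {a..b}"
proof (cases "a = b")
  case False
  with ab have ab': "a < b" by simp
  obtain N where N: "N \<in> null_sets lebesgue"
    and vd: "\<And>t. t \<in> {a..b} \<Longrightarrow> t \<notin> N \<Longrightarrow> (f has_vector_derivative f' t) (at t within {a..b})"
    using ae by (auto elim!: AE_E3)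
  \<comment> \<open>With the value 0 on \<open>N\<close>, a piece whose tag lies in \<open>N\<close>
    contributes just the increment of \<open>f\<close>. The change is undone at the end,
    \<open>N\<close> being negligible.\<close>
  define g where "g t = (if t \<in> N then 0 else f' t)" for t
  \<comment> \<open>This characterization of the integral allows an error of \<open>e\<close> times
    the length of the interval, the form in which the derivative estimates on single pieces add
    up.\<close>
  have "(g has_integral (f b - f a)) (cbox a b)"
    unfolding has_integral_factor_content
  proof safe
    fix e :: real assume e: "e > 0"
    then have "\<forall>x. \<exists>d>0. x \<in> {a..b} - N \<longrightarrow>
         (\<forall>y\<in>{a..b}. norm (y-x) < d \<longrightarrow> norm (f y - f x - (y-x) *\<^sub>R f' x) \<le> e/2 * norm (y-x))"
      using vd[unfolded has_vector_derivative_def has_derivative_within_alt] by (metis Diff_iff half_gt_zero zero_less_one)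
    then obtain d where d: "\<And>x. 0 < d x"
                 "\<And>x y. \<lbrakk>x \<in> {a..b} - N; y \<in> {a..b}; norm (y-x) < d x\<rbrakk>
                        \<Longrightarrow> norm (f y - f x - (y-x) *\<^sub>R f' x) \<le> e/2 * norm (y-x)"
      by metis
    \<comment> \<open>Half of the error budget is reserved for the tags in \<open>N\<close>, the
      other half for the differentiable ones.\<close>
    have "e / 2 * (b - a) > 0" using e ab' by simp
    from abs_continuous_on_finite[OF ac this]
    obtain \<delta> where \<delta>: "\<delta> > 0" and ac': "\<forall>(I :: (real \<times> real set) set) c d. finite I \<longrightarrow>
      (\<forall>i\<in>I. a \<le> c i \<and> c i \<le> d i \<and> d i \<le> b)
      \<longrightarrow> pairwise (\<lambda>i j. disjnt {c i<..<d i} {c j<..<d j}) I \<longrightarrow> (\<Sum>i\<in>I. d i - c i) < \<delta>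
      \<longrightarrow> (\<Sum>i\<in>I. norm (f (d i) - f (c i))) < e / 2 * (b - a)"
      by blast
    obtain G where G: "open G" "N \<subseteq> G" and GN: "G - N \<in> lmeasurable" "emeasure lebesgue (G - N) < ennreal \<delta>"
      using sets_lebesgue_outer_open[of N \<delta>] N \<delta> by auto
    have Gm: "G \<in> lmeasurable" and Gd: "measure lebesgue G < \<delta>"
    proof -
      have eq: "G = (G - N) \<union> N" using G by auto
      have "emeasure lebesgue G = emeasure lebesgue (G - N)"
        by (subst eq, rule emeasure_Un_null_set) (use GN N in auto)
      then have lt: "emeasure lebesgue G < ennreal \<delta>" using GN by simp
      then show "G \<in> lmeasurable" using G by (auto intro!: fmeasurableI order_less_trans[OF lt])
      then show "measure lebesgue G < \<delta>"
        using lt \<delta> by (simp add: emeasure_eq_measure2 ennreal_less_iff)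
    qed
    obtain r where r: "\<And>x. x \<in> G \<Longrightarrow> r x > 0 \<and> ball x (r x) \<subseteq> G"
      using G(1) unfolding open_contains_ball by metis
    define \<gamma> where "\<gamma> x = (if x \<in> N then ball x (r x) else ball x (d x))" for x
    show "\<exists>\<gamma>. gauge \<gamma> \<and> (\<forall>p. p tagged_division_of (cbox a b) \<and> \<gamma> fine p \<longrightarrow>
      norm ((\<Sum>(x, k)\<in>p. measure lborel k *\<^sub>R g x) - (f b - f a)) \<le> e * measure lborel (cbox a b))"
    proof (intro exI[of _ \<gamma>] conjI allI impI; (elim conjE)?)
      show "gauge \<gamma>" using r G(2) d(1) by (auto simp: gauge_def \<gamma>_def)
    next
      fix p assume p: "p tagged_division_of cbox a b" and fine: "\<gamma> fine p"
      have fin: "finite p" using p by auto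
      have K: "\<exists>u v. K = {u..v} \<and> u \<le> v \<and> Inf K = u \<and> Sup K = v \<and> x \<in> K \<and> a \<le> u \<and> v \<le> b"
        if xKp: "(x, K) \<in> p" for x K
      proof -
        obtain u v where "K = cbox u v" using tagged_division_ofD(4)[OF p xKp] by blast
        moreover have "x \<in> K" "K \<subseteq> cbox a b" using p xKp by auto
        ultimately show ?thesis by (intro exI[of _ u] exI[of _ v]) auto
      qed
      have IS: "Inf (snd z) \<le> Sup (snd z)" "a \<le> Inf (snd z)" "Sup (snd z) \<le> b" if "z \<in> p" for z
        using K[of "fst z" "snd z"] that by auto
      define F where "F = (\<lambda>(x::real, K). measure lborel K *\<^sub>R g x - (f (Sup K) - f (Inf K)))"
      define pN where "pN = {z \<in> p. fst z \<in> N}"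
      have ba: "b - a = (\<Sum>(x,K)\<in>p. Sup K - Inf K)" "f b - f a = (\<Sum>(x,K)\<in>p. f(Sup K) - f(Inf K))"
        using additive_tagged_division_1[where f= "\<lambda>x. x"] additive_tagged_division_1[where f= f]
              ab p by auto
      have good: "norm (F z) \<le> e/2 * (case z of (x, K) \<Rightarrow> Sup K - Inf K)" if z: "z \<in> p - pN" for z
      proof -
        obtain x K where zx: "z = (x, K)" by force
        have xKp: "(x, K) \<in> p" using z zx by auto
        obtain u v where uv: "K = {u..v}" "u \<le> v" "Inf K = u" "Sup K = v" "x \<in> K"
          "a \<le> u" "v \<le> b" using K[OF xKp] by blast
        have xN: "x \<notin> N" using z zx by (auto simp: pN_def)
        have "K \<subseteq> ball x (d x)" using fineD[OF fine xKp] xN by (simp add: \<gamma>_def)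
        moreover have "u \<in> K" "v \<in> K" using uv by auto
        ultimately have uvx: "norm (u - x) < d x" "norm (v - x) < d x"
          by (auto simp: dist_real_def subset_iff)
        have x: "x \<in> {a..b} - N" using uv xN by auto
        have "norm ((v - u) *\<^sub>R f' x - (f v - f u))
            = norm (f u - f x - (u - x) *\<^sub>R f' x - (f v - f x - (v - x) *\<^sub>R f' x))"
          by (auto simp: algebra_simps)
        also have "\<dots> \<le> norm (f u - f x - (u - x) *\<^sub>R f' x) + norm (f v - f x - (v - x) *\<^sub>R f' x)"
          by (rule norm_triangle_ineq4)
        also have "\<dots> \<le> e/2 * norm (u - x) + e/2 * norm (v - x)"
          by (intro add_mono d(2) x uvx) (use uv in auto)
        \<comment> \<open>The tag lies between the endpoints, so its distances to them add up to the
          length of the piece.\<close>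
        also have "\<dots> = e/2 * (v - u)" using uv by (auto simp: field_simps)
        finally show ?thesis using xN uv by (simp add: F_def zx g_def)
      qed
      have lens: "(\<Sum>(x,K)\<in>p - pN. Sup K - Inf K) \<le> b - a"
        unfolding ba by (rule sum_mono2) (use fin IS in \<open>auto simp: case_prod_unfold\<close>)
      have "norm (sum F (p - pN)) \<le> (\<Sum>z\<in>p - pN. e/2 * (case z of (x, K) \<Rightarrow> Sup K - Inf K))"
        by (rule sum_norm_le) (use good in auto)
      also have "\<dots> \<le> e/2 * (b - a)"
        unfolding sum_distrib_left[symmetric] using lens e by (simp add: case_prod_unfold)
      finally have g1: "norm (sum F (p - pN)) \<le> e/2 * (b - a)" .
      have dis: "pairwise (\<lambda>i j. disjnt {Inf (snd i)<..<Sup (snd i)} {Inf (snd j)<..<Sup (snd j)}) pN"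
      proof (rule pairwiseI)
        fix i j assume ij: "i \<in> pN" "j \<in> pN" "i \<noteq> j"
        obtain x K y L where e: "i = (x, K)" "j = (y, L)" by (metis surj_pair)
        have pp: "(x, K) \<in> p" "(y, L) \<in> p" "(x, K) \<noteq> (y, L)" using ij e by (auto simp: pN_def)
        have "interior K \<inter> interior L = {}" using p pp by (rule tagged_division_ofD(5))
        moreover have "interior K = {Inf K<..<Sup K}" "interior L = {Inf L<..<Sup L}"
          using K[OF pp(1)] K[OF pp(2)] by (metis interior_atLeastAtMost_real)+
        ultimately show "disjnt {Inf (snd i)<..<Sup (snd i)} {Inf (snd j)<..<Sup (snd j)}"
          by (simp add: e disjnt_def)
      qed
      \<comment> \<open>The interiors are pairwise disjoint and contained in \<open>G\<close>, so
        their total length is at most the measure of \<open>G\<close>, hence below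
        \<open>\<delta>\<close>.\<close>
      have "(\<Sum>i\<in>pN. Sup (snd i) - Inf (snd i)) = (\<Sum>i\<in>pN. measure lebesgue {Inf (snd i)<..<Sup (snd i)})"
        by (rule sum.cong) (use IS in \<open>auto simp: pN_def\<close>)
      also have "\<dots> = measure lebesgue (\<Union>i\<in>pN. {Inf (snd i)<..<Sup (snd i)})"
        by (rule measure_UNION'[symmetric]) (use fin dis in \<open>auto simp: pN_def\<close>)
      also have "\<dots> \<le> measure lebesgue G"
      proof (rule measure_mono_fmeasurable)
        show "(\<Union>i\<in>pN. {Inf (snd i)<..<Sup (snd i)}) \<subseteq> G"
        proof (rule UN_least)
          fix i assume i: "i \<in> pN"
          obtain x K where e: "i = (x, K)" by force
          have "x \<in> N" and xp: "(x, K) \<in> p" using i e by (auto simp: pN_def)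
          moreover have "K \<subseteq> \<gamma> x" using fineD[OF fine xp] .
          ultimately have "K \<subseteq> G" using r[of x] G(2) by (auto simp: \<gamma>_def)
          moreover have "{Inf K<..<Sup K} \<subseteq> K"
            using K[OF xp] by (metis greaterThanLessThan_subseteq_atLeastAtMost_iff order_refl)
          ultimately show "{Inf (snd i)<..<Sup (snd i)} \<subseteq> G" by (simp add: e)
        qed
      qed (use Gm fin in \<open>auto simp: pN_def intro!: sets.finite_UN\<close>)
      finally have "(\<Sum>i\<in>pN. Sup (snd i) - Inf (snd i)) < \<delta>" using Gd by simp
      then have "(\<Sum>i\<in>pN. norm (f (Sup (snd i)) - f (Inf (snd i)))) < e/2 * (b - a)"
        by (intro ac'[rule_format, of pN "\<lambda>i. Inf (snd i)" "\<lambda>i. Sup (snd i)"] dis)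
          (use fin IS in \<open>auto simp: pN_def\<close>)
      moreover have "norm (sum F pN) \<le> (\<Sum>i\<in>pN. norm (f (Sup (snd i)) - f (Inf (snd i))))"
        by (rule sum_norm_le) (auto simp: pN_def F_def g_def norm_minus_commute)
      ultimately have g2: "norm (sum F pN) \<le> e/2 * (b - a)" by simp
      have "(\<Sum>(x, k)\<in>p. measure lborel k *\<^sub>R g x) - (f b - f a) = sum F p"
        unfolding ba(2) F_def by (simp add: case_prod_unfold sum_subtractf)
      also have "\<dots> = sum F (p - pN) + sum F pN"
        by (rule sum.subset_diff) (use fin in \<open>auto simp: pN_def\<close>)
      also have "norm \<dots> \<le> e/2 * (b - a) + e/2 * (b - a)"
        by (rule norm_triangle_le) (use g1 g2 in simp)
      finally show "norm ((\<Sum>(x, k)\<in>p. measure lborel k *\<^sub>R g x) - (f b - f a)) \<le> e * measure lborel (cbox a b)"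
        using ab by (simp add: field_simps)
    qed
  qed
  then show ?thesis
    unfolding box_real(2)
    by (rule has_integral_spike[of N, rotated 2]) (use N in \<open>auto simp: g_def negligible_iff_null_sets\<close>)
qed (use has_integral_refl in auto)

text \<open>Integrating the derivative shows that \<open>f\<close> is Lipschitz. The finite set
  \<open>S\<close> will hold the sampling times, where a trajectory may have a corner.\<close>

lemma abs_continuous_on_bounded_derivative:
  fixes f :: "real \<Rightarrow> 'a::banach"
  assumes cont: "continuous_on {a..b} f" and "finite S"
    and vd: "\<And>t. t \<in> {a<..<b} - S \<Longrightarrow> (f has_vector_derivative f' t) (at t)"
    and bd: "\<And>t. t \<in> {a<..<b} - S \<Longrightarrow> norm (f' t) \<le> M"
  shows "abs_continuous_on a b f"
proof -
  \<comment> \<open>The maximum with 0 is there because \<open>M\<close> may be negative when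
    \<open>{a<..<b} - S\<close> is empty.\<close>
  have lip: "norm (f y - f x) \<le> max M 0 * (y - x)" if xy: "a \<le> x" "x \<le> y" "y \<le> b" for x y
  proof -
    have "(f' has_integral (f y - f x)) {x..y}"
    proof (rule fundamental_theorem_of_calculus_interior_strong[OF \<open>finite S\<close> xy(2)])
      fix t assume "t \<in> {x<..<y} - S"
      then show "(f has_vector_derivative f' t) (at t)" using xy by (intro vd) auto
    qed (use xy in \<open>auto intro!: continuous_on_subset[OF cont]\<close>)
    then have "norm (f y - f x) \<le> max M 0 * measure lborel {x..y}"
    \<comment> \<open>The endpoints join the exceptional set, since \<open>x = a\<close> or
      \<open>y = b\<close> may occur and the bound is only known strictly inside.\<close>
    proof (rule has_integral_bound_real[of _ "S \<union> {x, y}", rotated 2])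
      fix t assume "t \<in> {x..y} - (S \<union> {x, y})"
      then have "t \<in> {a<..<b} - S" using xy by auto
      then show "norm (f' t) \<le> max M 0" using bd by (simp add: max.coboundedI1)
    qed (use \<open>finite S\<close> in auto)
    then show ?thesis using xy by simp
  qed
  show ?thesis
    unfolding abs_continuous_on_def
  proof (intro allI impI)
    fix \<epsilon> :: real assume e: "\<epsilon> > 0"
    show "\<exists>\<delta>>0. \<forall>(k::nat) c d.
       (\<forall>i<k. a \<le> c i \<and> c i \<le> d i \<and> d i \<le> b) \<longrightarrow>
       (\<forall>i<k. \<forall>j<k. i \<noteq> j \<longrightarrow> {c i<..<d i} \<inter> {c j<..<d j} = {}) \<longrightarrow>
       (\<Sum>i<k. d i - c i) < \<delta> \<longrightarrow> (\<Sum>i<k. norm (f (d i) - f (c i))) < \<epsilon>"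
    \<comment> \<open>The added 1 keeps the denominator positive even if the Lipschitz constant is
      0.\<close>
    proof (intro exI[of _ "\<epsilon> / (max M 0 + 1)"] conjI allI impI)
      fix k :: nat and c d :: "nat \<Rightarrow> real"
      assume cd: "\<forall>i<k. a \<le> c i \<and> c i \<le> d i \<and> d i \<le> b"
        and sm: "(\<Sum>i<k. d i - c i) < \<epsilon> / (max M 0 + 1)"
      have "(\<Sum>i<k. norm (f (d i) - f (c i))) \<le> (\<Sum>i<k. (max M 0 + 1) * (d i - c i))"
      proof (rule sum_mono)
        fix i assume "i \<in> {..<k}"
        then have i: "a \<le> c i" "c i \<le> d i" "d i \<le> b" using cd by auto
        have "norm (f (d i) - f (c i)) \<le> max M 0 * (d i - c i)" by (rule lip[OF i])
        also have "\<dots> \<le> (max M 0 + 1) * (d i - c i)" using i by (intro mult_right_mono) auto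
        finally show "norm (f (d i) - f (c i)) \<le> (max M 0 + 1) * (d i - c i)" .
      qed
      also have "\<dots> = (max M 0 + 1) * (\<Sum>i<k. d i - c i)" by (simp add: sum_distrib_left)
      also have "\<dots> < \<epsilon>" using sm by (simp add: field_simps)
      finally show "(\<Sum>i<k. norm (f (d i) - f (c i))) < \<epsilon>" .
    qed (use e in auto)
  qed
qed

section \<open>Linear differential equations\<close>

text \<open>Picard iteration: the increments \<open>Y n\<close> are bounded by the terms of an exponential series.\<close>

lemma linear_ode_exists:
  fixes A :: "real \<Rightarrow> real^'n^'n"
  assumes A: "continuous_on {a..b} A" and ab: "a \<le> b"
  obtains \<Phi> where "\<And>t. t \<in> {a..b} \<Longrightarrow> (\<Phi> has_vector_derivative A t ** \<Phi> t) (at t within {a..b})"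
    and "\<Phi> a = mat 1"
proof -
  interpret mm: bounded_bilinear "(**) :: real^'n^'n \<Rightarrow> real^'n^'n \<Rightarrow> real^'n^'n"
    by (rule bounded_bilinear_matrix_matrix_mult)
  obtain C where C: "C > 0" "\<And>X Y. norm ((X :: real^'n^'n) ** (Y :: real^'n^'n)) \<le> norm X * norm Y * C"
    using mm.pos_bounded by blast
  obtain M where M: "M > 0" "\<And>t. t \<in> {a..b} \<Longrightarrow> norm (A t) \<le> M"
    using compact_imp_bounded[OF compact_continuous_image[OF A compact_Icc]]
    by (auto simp: bounded_pos)
  \<comment> \<open>\<open>M\<close> bounds \<open>A\<close> on the interval and \<open>C\<close> is
    the bound of the matrix product as a bilinear map, so \<open>L\<close> is a Lipschitz constant
    of the right-hand side, uniform in time.\<close>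
  define L where "L = M * C"
  have L: "L > 0" using C M by (simp add: L_def)
  have AL: "norm (A t ** X) \<le> L * norm X" if "t \<in> {a..b}" for t and X :: "real^'n^'n"
  proof -
    have "norm (A t ** X) \<le> norm (A t) * norm X * C" by (rule C)
    also have "\<dots> \<le> M * norm X * C" using M(2)[OF that] C by (intro mult_right_mono) auto
    finally show ?thesis by (simp add: L_def mult_ac)
  qed
  \<comment> \<open>The sum of these iterated integrals is the Peano-Baker series, which is the
    matrix exponential when \<open>A\<close> is constant.\<close>
  define Y where "Y = rec_nat (\<lambda>_. mat 1 :: real^'n^'n) (\<lambda>n y t. integral {a..t} (\<lambda>s. A s ** y s))"
  have Y0: "Y 0 t = mat 1" and YS: "Y (Suc n) t = integral {a..t} (\<lambda>s. A s ** Y n s)" for n t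
    by (simp_all add: Y_def)
  have cont: "continuous_on {a..b} (Y n)" for n
  proof (induction n)
    case 0
    then show ?case by (simp add: Y_def)
  next
    case (Suc n)
    then have "(\<lambda>s. A s ** Y n s) integrable_on {a..b}"
      by (intro integrable_continuous_real continuous_intros A)
    then show ?case unfolding YS by (rule indefinite_integral_continuous_1)
  qed
  have contA: "continuous_on {a..b} (\<lambda>s. A s ** Y n s)" for n
    by (intro continuous_intros A cont)
  have der: "(Y (Suc n) has_vector_derivative A t ** Y n t) (at t within {a..b})"
    if "t \<in> {a..b}" for n t
    unfolding YS[abs_def] by (rule integral_has_vector_derivative[OF contA that])
  define c where "c = norm (mat 1 :: real^'n^'n)"
  have bd: "norm (Y n t) \<le> c * ((L * (t - a)) ^ n / fact n)" if "t \<in> {a..b}" for n t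
    using that
  proof (induction n arbitrary: t)
    case 0
    then show ?case by (simp add: Y0 c_def)
  next
    case (Suc n)
    let ?h = "\<lambda>k s. c * ((L * (s - a)) ^ k / fact k)"
    have sub: "{a..t} \<subseteq> {a..b}" using Suc.prems by auto
    \<comment> \<open>The bound of index \<open>Suc n\<close> is the antiderivative, vanishing at
      \<open>a\<close>, of \<open>L\<close> times the bound of index \<open>n\<close>; integration
      produces the factorial.\<close>
    have "((\<lambda>s. L * ?h n s) has_integral (?h (Suc n) t - ?h (Suc n) a)) {a..t}"
    proof (rule fundamental_theorem_of_calculus)
      fix s assume "s \<in> {a..t}"
      have "((\<lambda>s. (L * (s - a)) ^ Suc n) has_real_derivative real (Suc n) * (L * (s - a)) ^ n * L) (at s within {a..t})"
        by (auto intro!: derivative_eq_intros simp del: power_Suc)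
      from DERIV_cmult[OF this, of "c / fact (Suc n)"]
      have "(?h (Suc n) has_real_derivative c / fact (Suc n) * (real (Suc n) * (L * (s - a)) ^ n * L)) (at s within {a..t})"
        by simp
      moreover have "c / fact (Suc n) * (real (Suc n) * X * L) = L * (c * (X / fact n))" for X
        unfolding fact_Suc by (simp add: divide_simps del: of_nat_Suc)
      ultimately have "(?h (Suc n) has_real_derivative L * ?h n s) (at s within {a..t})"
        by (simp add: mult_ac)
      then show "(?h (Suc n) has_vector_derivative L * ?h n s) (at s within {a..t})"
        by (simp add: has_real_derivative_iff_has_vector_derivative)
    qed (use Suc.prems in auto)
    then have int: "((\<lambda>s. L * ?h n s) has_integral ?h (Suc n) t) {a..t}" by simp
    have "norm (integral {a..t} (\<lambda>s. A s ** Y n s)) \<le> integral {a..t} (\<lambda>s. L * ?h n s)"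
    proof (rule integral_norm_bound_integral)
      show "(\<lambda>s. A s ** Y n s) integrable_on {a..t}"
        by (intro integrable_continuous_real continuous_on_subset[OF contA sub])
      show "(\<lambda>s. L * ?h n s) integrable_on {a..t}" using int by blast
      fix s assume s: "s \<in> {a..t}"
      then have s': "s \<in> {a..b}" using sub by auto
      show "norm (A s ** Y n s) \<le> L * ?h n s"
        by (rule order_trans[OF AL[OF s'] mult_left_mono[OF Suc.IH[OF s']]]) (use L in simp)
    qed
    then show ?case unfolding YS integral_unique[OF int] .
  qed
  define m where "m n = c * ((L * (b - a)) ^ n / fact n)" for n
  have bdm: "norm (Y n t) \<le> m n" if "t \<in> {a..b}" for n t
  proof -
    have "(L * (t - a)) ^ n \<le> (L * (b - a)) ^ n"
      using L that by (intro power_mono mult_left_mono) auto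
    then have "c * ((L * (t - a)) ^ n / fact n) \<le> m n"
      unfolding m_def by (intro mult_left_mono divide_right_mono) (auto simp: c_def)
    with bd[OF that, of n] show ?thesis by simp
  qed
  have sm: "summable m"
    unfolding m_def using summable_exp[of "L * (b - a)"]
    by (intro summable_mult) (simp add: divide_inverse mult.commute)
  \<comment> \<open>\<open>D n\<close> is the derivative of \<open>Y n\<close>. The index is shifted
    because \<open>Y 0\<close> is constant; thus the sum of the \<open>D n\<close> is
    \<open>A t\<close> times the sum of the \<open>Y n\<close>.\<close>
  define D where "D n t = (case n of 0 \<Rightarrow> 0 | Suc k \<Rightarrow> A t ** Y k t)" for n t
  define g' where "g' t = (\<Sum>n. D n t)" for t
  define m' where "m' n = (case n of 0 \<Rightarrow> 0 | Suc k \<Rightarrow> L * m k)" for n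
  have "uniform_limit {a..b} (\<lambda>n t. \<Sum>i<n. D i t) (\<lambda>t. suminf (\<lambda>i. D i t)) sequentially"
  proof (rule Weierstrass_m_test)
    fix n t assume t: "t \<in> {a..b}"
    show "norm (D n t) \<le> m' n"
    proof (cases n)
      case (Suc k)
      have "norm (A t ** Y k t) \<le> L * m k"
        by (rule order_trans[OF AL[OF t] mult_left_mono[OF bdm[OF t]]]) (use L in simp)
      then show ?thesis by (simp add: D_def m'_def Suc)
    qed (simp add: D_def m'_def)
  next
    have "summable (\<lambda>n. m' (Suc n))" using sm by (simp add: m'_def summable_mult)
    then show "summable m'" by (simp only: summable_Suc_iff)
  qed
  then have ul: "uniform_limit {a..b} (\<lambda>n t. \<Sum>i<n. D i t) g' sequentially"
    by (simp add: g'_def[abs_def])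
  have Ya: "(\<lambda>n. Y n a) sums mat 1"
  proof -
    have "(\<lambda>n. Y n a) = (\<lambda>n. if n = 0 then mat 1 else 0)"
      by (rule ext, case_tac n) (auto simp: Y0 YS)
    then show ?thesis using sums_If_finite_set[of "{0}" "\<lambda>_. mat 1 :: real^'n^'n"] by simp
  qed
  have "\<exists>g. \<forall>t\<in>{a..b}. (\<lambda>n. Y n t) sums (g t) \<and> (g has_derivative (\<lambda>h. h *\<^sub>R g' t)) (at t within {a..b})"
  proof (rule has_derivative_series[where f' = "\<lambda>n t h. h *\<^sub>R D n t"])
    show "(Y n has_derivative (\<lambda>h. h *\<^sub>R D n t)) (at t within {a..b})" if "t \<in> {a..b}" for n t
    proof (cases n)
      case 0
      have "Y 0 = (\<lambda>t. mat 1)" by (simp add: Y_def)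
      then show ?thesis by (simp add: 0 D_def)
    next
      case (Suc k)
      then show ?thesis using der[OF that, of k] by (simp add: has_vector_derivative_def D_def)
    qed
  next
    fix e :: real assume "e > 0"
    then have "\<forall>\<^sub>F n in sequentially. \<forall>t\<in>{a..b}. dist (\<Sum>i<n. D i t) (g' t) < e"
      using ul by (simp add: uniform_limit_iff)
    then show "\<forall>\<^sub>F n in sequentially. \<forall>t\<in>{a..b}. \<forall>h. norm ((\<Sum>i<n. h *\<^sub>R D i t) - h *\<^sub>R g' t) \<le> e * norm h"
    proof eventually_elim
      case (elim n)
      show ?case
      proof (intro ballI allI)
        fix t h assume "t \<in> {a..b}"
        with elim have "norm ((\<Sum>i<n. D i t) - g' t) \<le> e" by (auto simp: dist_norm less_imp_le)
        then have "\<bar>h\<bar> * norm ((\<Sum>i<n. D i t) - g' t) \<le> \<bar>h\<bar> * e" by (intro mult_left_mono) auto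
        then show "norm ((\<Sum>i<n. h *\<^sub>R D i t) - h *\<^sub>R g' t) \<le> e * norm h"
          by (simp add: scaleR_sum_right[symmetric] scaleR_diff_right[symmetric] mult.commute)
      qed
    qed
  qed (use Ya ab in auto)
  then obtain g where g: "\<And>t. t \<in> {a..b} \<Longrightarrow> (\<lambda>n. Y n t) sums (g t)"
    "\<And>t. t \<in> {a..b} \<Longrightarrow> (g has_vector_derivative g' t) (at t within {a..b})"
    unfolding has_vector_derivative_def by blast
  have "g' t = A t ** g t" if "t \<in> {a..b}" for t
  proof -
    have "(\<lambda>n. A t ** Y n t) sums (A t ** g t)"
      by (rule bounded_linear.sums[OF mm.bounded_linear_right g(1)[OF that]])
    then have "(\<lambda>n. D (Suc n) t) sums (A t ** g t)" by (simp add: D_def)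
    then have "(\<lambda>n. D n t) sums (A t ** g t)" using sums_Suc_iff[of "\<lambda>n. D n t" "A t ** g t"] by (simp add: D_def)
    then show ?thesis by (simp add: g'_def sums_iff)
  qed
  moreover have "g a = mat 1" using sums_unique2[OF g(1)[of a] Ya] ab by simp
  ultimately show thesis using g(2) by (intro that[of g]) auto
qed

text \<open>The inverse of \<open>\<Phi>\<close> is constructed rather than shown to exist by a
  determinant: \<open>\<Psi>\<close> is the transpose of a solution of the adjoint equation with
  matrix \<open>- transpose (A t)\<close>. The product \<open>\<Psi> t ** \<Phi> t\<close> then has
  derivative zero and is the identity at \<open>a\<close>; for square matrices a left inverse is a
  right inverse.\<close>

lemma fundamental_matrix_exists:
  fixes A :: "real \<Rightarrow> real^'n^'n"
  assumes A: "continuous_on {a..b} A" and ab: "a \<le> b"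
  obtains \<Phi> \<Psi> where
    "\<And>t. t \<in> {a..b} \<Longrightarrow> (\<Phi> has_vector_derivative A t ** \<Phi> t) (at t within {a..b})"
    "\<And>t. t \<in> {a..b} \<Longrightarrow> (\<Psi> has_vector_derivative - (\<Psi> t ** A t)) (at t within {a..b})"
    "\<And>t. t \<in> {a..b} \<Longrightarrow> \<Psi> t ** \<Phi> t = mat 1"
    "\<And>t. t \<in> {a..b} \<Longrightarrow> \<Phi> t ** \<Psi> t = mat 1"
    "\<Phi> a = mat 1" "\<Psi> a = mat 1"
proof -
  interpret mm: bounded_bilinear "(**) :: real^'n^'n \<Rightarrow> real^'n^'n \<Rightarrow> real^'n^'n"
    by (rule bounded_bilinear_matrix_matrix_mult)
  obtain \<Phi> where \<Phi>: "\<And>t. t \<in> {a..b} \<Longrightarrow> (\<Phi> has_vector_derivative A t ** \<Phi> t) (at t within {a..b})"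
      "\<Phi> a = mat 1"
    using linear_ode_exists[OF A ab] by blast
  have "continuous_on {a..b} (\<lambda>t. - transpose (A t))" by (intro continuous_intros A)
  from linear_ode_exists[OF this ab] obtain \<Theta> where
    \<Theta>: "\<And>t. t \<in> {a..b} \<Longrightarrow> (\<Theta> has_vector_derivative - transpose (A t) ** \<Theta> t) (at t within {a..b})"
      "\<Theta> a = mat 1" by blast
  define \<Psi> where "\<Psi> t = transpose (\<Theta> t)" for t
  have \<Psi>: "(\<Psi> has_vector_derivative - (\<Psi> t ** A t)) (at t within {a..b})" if "t \<in> {a..b}" for t
  proof -
    have "((\<lambda>t. transpose (\<Theta> t)) has_vector_derivative transpose (- transpose (A t) ** \<Theta> t)) (at t within {a..b})"
      by (rule bounded_linear.has_vector_derivative[OF bounded_linear_transpose \<Theta>(1)[OF that]])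
    moreover have "transpose (- transpose (A t) ** \<Theta> t) = - (\<Psi> t ** A t)"
      by (simp add: \<Psi>_def mm.minus_left matrix_transpose_mul
          linear_neg[OF bounded_linear.linear[OF bounded_linear_transpose]])
    ultimately show ?thesis by (simp add: \<Psi>_def[abs_def])
  qed
  have "\<Psi> t ** \<Phi> t = mat 1" if t: "t \<in> {a..b}" for t
  proof -
    have "((\<lambda>t. \<Psi> t ** \<Phi> t) has_vector_derivative 0) (at s within {a..b})" if s: "s \<in> {a..b}" for s
      using mm.has_vector_derivative[OF \<Psi>[OF s] \<Phi>(1)[OF s]]
      by (simp add: mm.minus_left matrix_mul_assoc)
    then obtain c where "\<And>s. s \<in> {a..b} \<Longrightarrow> \<Psi> s ** \<Phi> s = c"
      using has_vector_derivative_zero_constant[of "{a..b}" "\<lambda>t. \<Psi> t ** \<Phi> t"] by auto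
    from this[OF t] this[of a] show ?thesis using ab \<Phi>(2) \<Theta>(2) by (simp add: \<Psi>_def)
  qed
  moreover from this have "\<Phi> t ** \<Psi> t = mat 1" if "t \<in> {a..b}" for t
    using that by (simp add: matrix_left_right_inverse)
  ultimately show thesis using \<Phi> \<Psi> \<Theta>(2) by (intro that[of \<Phi> \<Psi>]) (auto simp: \<Psi>_def)
qed

text \<open>The action \<open>act\<close> allows vector-valued as well as matrix-valued solutions.\<close>

lemma linear_ode_unique:
  fixes A \<Psi> :: "real \<Rightarrow> real^'n^'n" and act :: "real^'n^'n \<Rightarrow> 'a::real_normed_vector \<Rightarrow> 'a"
  assumes bil: "bounded_bilinear act" and assoc: "\<And>X Y z. act (X ** Y) z = act X (act Y z)"
    and \<Psi>: "\<And>t. t \<in> {a..b} \<Longrightarrow> (\<Psi> has_vector_derivative - (\<Psi> t ** A t)) (at t within {a..b})"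
    and y: "\<And>t. t \<in> {a..b} \<Longrightarrow> (y has_vector_derivative act (A t) (y t)) (at t within {a..b})"
    and "s \<in> {a..b}" "t \<in> {a..b}"
  shows "act (\<Psi> t) (y t) = act (\<Psi> s) (y s)"
proof -
  interpret bounded_bilinear act by fact
  \<comment> \<open>The two terms of the product rule cancel. Callers recover \<open>y\<close> by
    applying the inverse of \<open>\<Psi> t\<close>.\<close>
  have "((\<lambda>t. act (\<Psi> t) (y t)) has_vector_derivative 0) (at s within {a..b})" if s: "s \<in> {a..b}" for s
    using has_vector_derivative[OF \<Psi>[OF s] y[OF s]] by (simp add: minus_left assoc)
  then obtain c where "\<And>s. s \<in> {a..b} \<Longrightarrow> act (\<Psi> s) (y s) = c"
    using has_vector_derivative_zero_constant[of "{a..b}" "\<lambda>t. act (\<Psi> t) (y t)"] by auto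
  with assms show ?thesis by metis
qed

lemma has_integral_combine_sum:
  fixes f :: "real \<Rightarrow> 'a::banach" and s :: "nat \<Rightarrow> real"
  assumes "\<And>i. i < k \<Longrightarrow> s i \<le> s (Suc i)"
    and "\<And>i. i < k \<Longrightarrow> (f has_integral I i) {s i..s (Suc i)}"
  shows "(f has_integral (\<Sum>i<k. I i)) {s 0..s k}"
  using assms
proof (induction k)
  case (Suc k)
  have "s 0 \<le> s j" if "j \<le> k" for j
    using that by (induction j) (auto intro: order_trans[OF _ Suc.prems(1)])
  with Suc show ?case by (auto intro: has_integral_combine)
qed auto

section \<open>Sampled-data controls\<close>

locale lq_problem =
  fixes D :: "('n::finite, 'm::finite) lq_data"
  assumes interval: "t_start D < t_end D"
    and S_psd: "sym_pos_semidef (S_mat D)"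
    and x_cont: "continuous_on {t_start D..t_end D} (x_ref D)"
    and drift_cont: "continuous_on {t_start D..t_end D} (drift D)"
    and v_cont: "continuous_on {t_start D..t_end D} (v_ref D)"
    and A_cont: "continuous_on {t_start D..t_end D} (A_mat D)"
    and B_cont: "continuous_on {t_start D..t_end D} (B_mat D)"
    and W_cont: "continuous_on {t_start D..t_end D} (W_mat D)"
    and R_cont: "continuous_on {t_start D..t_end D} (R_mat D)"
    and W_psd: "\<And>t. t \<in> {t_start D..t_end D} \<Longrightarrow> sym_pos_semidef (W_mat D t)"
    and R_pd: "\<And>t. t \<in> {t_start D..t_end D} \<Longrightarrow> sym_pos_def (R_mat D t)"
    and step_pos: "\<And>i. i < n_steps D \<Longrightarrow> 0 < step D i"
    and step_sum: "(\<Sum>i<n_steps D. step D i) = t_end D - t_start D"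
begin

abbreviation "ta \<equiv> t_start D"
abbreviation "tb \<equiv> t_end D"
abbreviation "\<sigma> \<equiv> sample_time D"
abbreviation "N \<equiv> n_steps D"
abbreviation "Z \<equiv> Ztr D"

lemma sample_time_0: "\<sigma> 0 = ta" by (simp add: sample_time_def)

lemma sample_time_N: "\<sigma> N = tb" by (simp add: sample_time_def step_sum)

lemma sample_time_less: "i < N \<Longrightarrow> \<sigma> i < \<sigma> (Suc i)"
  by (simp add: sample_time_def step_pos)

lemma sample_time_mono: "i \<le> j \<Longrightarrow> j \<le> N \<Longrightarrow> \<sigma> i \<le> \<sigma> j"
proof (induction j rule: dec_induct)
  case (step j)
  then show ?case using sample_time_less[of j] by simp
qed simp

lemma sample_time_in: "i \<le> N \<Longrightarrow> \<sigma> i \<in> {ta..tb}"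
  using sample_time_mono[of 0 i] sample_time_mono[of i N] sample_time_0 sample_time_N by simp

lemma samp_interval_subset: "i < N \<Longrightarrow> samp_interval D i \<subseteq> {ta..tb}"
  using sample_time_in[of i] sample_time_in[of "Suc i"] by auto

lemma sample_piece_exists:
  assumes "t \<in> {ta..<tb}"
  obtains i where "i < N" "t \<in> {\<sigma> i..<\<sigma> (Suc i)}"
proof -
  have "\<exists>i<k. t \<in> {\<sigma> i..<\<sigma> (Suc i)}" if "k \<le> N" "t \<in> {\<sigma> 0..<\<sigma> k}" for k
    using that
  proof (induction k)
    case (Suc k)
    show ?case
    proof (cases "t < \<sigma> k")
      case True
      then obtain i where "i < k" "t \<in> {\<sigma> i..<\<sigma> (Suc i)}" using Suc by auto
      then show ?thesis by (auto intro: less_SucI)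
    qed (use Suc.prems in auto)
  qed auto
  from this[of N] that show thesis using assms by (auto simp: sample_time_0 sample_time_N)
qed

lemma sample_piece_unique:
  assumes "i < N" "j < N" "t \<in> {\<sigma> i..<\<sigma> (Suc i)}" "t \<in> {\<sigma> j..<\<sigma> (Suc j)}"
  shows "i = j"
proof -
  have "\<not> i < j" using sample_time_mono[of "Suc i" j] assms by auto
  moreover have "\<not> j < i" using sample_time_mono[of "Suc j" i] assms by auto
  ultimately show ?thesis by simp
qed

subsection \<open>Transition matrix\<close>

text \<open>For fixed \<open>s\<close>, the map \<open>\<Phi> t ** \<Psi> s\<close> solves the
  defining initial value problem, and it is the only solution \<open>Y\<close> because
  \<open>\<Psi> r ** Y r\<close> is constant in \<open>r\<close>. Restriction to the interval
  provides the extensionality that the definite description demands.\<close>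

lemma transition_matrix:
  obtains \<Phi> \<Psi> where
    "\<And>t. t \<in> {ta..tb} \<Longrightarrow> (\<Phi> has_vector_derivative A_mat D t ** \<Phi> t) (at t within {ta..tb})"
    "\<And>t. t \<in> {ta..tb} \<Longrightarrow> (\<Psi> has_vector_derivative - (\<Psi> t ** A_mat D t)) (at t within {ta..tb})"
    "\<And>t. t \<in> {ta..tb} \<Longrightarrow> \<Psi> t ** \<Phi> t = mat 1"
    "\<And>t. t \<in> {ta..tb} \<Longrightarrow> \<Phi> t ** \<Psi> t = mat 1"
    "\<And>t s. t \<in> {ta..tb} \<Longrightarrow> s \<in> {ta..tb} \<Longrightarrow> Z t s = \<Phi> t ** \<Psi> s"
    "\<Phi> ta = mat 1"
proof -
  obtain \<Phi> \<Psi> where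
    F: "\<And>t. t \<in> {ta..tb} \<Longrightarrow> (\<Phi> has_vector_derivative A_mat D t ** \<Phi> t) (at t within {ta..tb})"
    and P: "\<And>t. t \<in> {ta..tb} \<Longrightarrow> (\<Psi> has_vector_derivative - (\<Psi> t ** A_mat D t)) (at t within {ta..tb})"
    and PF: "\<And>t. t \<in> {ta..tb} \<Longrightarrow> \<Psi> t ** \<Phi> t = mat 1"
    and FP: "\<And>t. t \<in> {ta..tb} \<Longrightarrow> \<Phi> t ** \<Psi> t = mat 1"
    and F0: "\<Phi> ta = mat 1" "\<Psi> ta = mat 1"
    using fundamental_matrix_exists[OF A_cont] interval by (metis less_imp_le)
  have "Z t s = \<Phi> t ** \<Psi> s" if t: "t \<in> {ta..tb}" and s: "s \<in> {ta..tb}" for t s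
  proof -
    let ?Y = "restrict (\<lambda>t. \<Phi> t ** \<Psi> s) {ta..tb}"
    have "(THE Y. is_transition D s Y) = ?Y"
    proof (rule the_equality)
      have "(?Y has_vector_derivative A_mat D t ** ?Y t) (at t within {ta..tb})"
        if t: "t \<in> {ta..tb}" for t
      proof (rule has_vector_derivative_transform[OF t])
        show "((\<lambda>t. \<Phi> t ** \<Psi> s) has_vector_derivative A_mat D t ** ?Y t) (at t within {ta..tb})"
          using bounded_bilinear.has_vector_derivative[OF bounded_bilinear_matrix_matrix_mult F[OF t]
              has_vector_derivative_const[of "\<Psi> s"]] t
          by (simp add: matrix_mul_assoc bounded_bilinear.zero_right[OF bounded_bilinear_matrix_matrix_mult])
      qed simp
      then show "is_transition D s ?Y"
        using FP[OF s] s by (simp add: is_transition_def)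
    next
      fix Y assume Y: "is_transition D s Y"
      have "\<Psi> r ** Y r = \<Psi> s ** Y s" if "r \<in> {ta..tb}" for r
        by (rule linear_ode_unique[OF bounded_bilinear_matrix_matrix_mult matrix_mul_assoc[symmetric] P _ s that])
          (use Y in \<open>auto simp: is_transition_def\<close>)
      then have "Y r = \<Phi> r ** \<Psi> s" if "r \<in> {ta..tb}" for r
        using that FP[OF that] Y by (metis is_transition_def matrix_mul_assoc matrix_mul_lid matrix_mul_rid)
      then show "Y = ?Y"
        using Y by (intro extensionalityI[of _ "{ta..tb}"]) (auto simp: is_transition_def)
    qed
    then show ?thesis using t by (simp add: Ztr_def)
  qed
  then show thesis using that F P PF FP F0 by blast
qed

text \<open>Names the obtained matrices once and for all. Both are the identity at
  \<open>ta\<close>, so on the interval the factorization of \<open>Z\<close> returns them as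
  \<open>Z t ta\<close> and \<open>Z ta s\<close>.\<close>

definition "Phi t = Z t ta"
definition "Psi s = Z ta s"

lemma
  shows Phi_derivative: "t \<in> {ta..tb} \<Longrightarrow> (Phi has_vector_derivative A_mat D t ** Phi t) (at t within {ta..tb})"
    and Psi_derivative: "t \<in> {ta..tb} \<Longrightarrow> (Psi has_vector_derivative - (Psi t ** A_mat D t)) (at t within {ta..tb})"
    and Phi_Psi: "t \<in> {ta..tb} \<Longrightarrow> Phi t ** Psi t = mat 1"
    and Psi_Phi: "t \<in> {ta..tb} \<Longrightarrow> Psi t ** Phi t = mat 1"
    and Ztr_eq: "\<And>s. t \<in> {ta..tb} \<Longrightarrow> s \<in> {ta..tb} \<Longrightarrow> Z t s = Phi t ** Psi s"
    and Phi_start: "Phi ta = mat 1"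
proof -
  obtain \<Phi> \<Psi> where
    F: "\<And>t. t \<in> {ta..tb} \<Longrightarrow> (\<Phi> has_vector_derivative A_mat D t ** \<Phi> t) (at t within {ta..tb})"
    and P: "\<And>t. t \<in> {ta..tb} \<Longrightarrow> (\<Psi> has_vector_derivative - (\<Psi> t ** A_mat D t)) (at t within {ta..tb})"
    and PF: "\<And>t. t \<in> {ta..tb} \<Longrightarrow> \<Psi> t ** \<Phi> t = mat 1"
    and FP: "\<And>t. t \<in> {ta..tb} \<Longrightarrow> \<Phi> t ** \<Psi> t = mat 1"
    and Z: "\<And>t s. t \<in> {ta..tb} \<Longrightarrow> s \<in> {ta..tb} \<Longrightarrow> Z t s = \<Phi> t ** \<Psi> s"
    and F0: "\<Phi> ta = mat 1"
    using transition_matrix by blast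
  have ta: "ta \<in> {ta..tb}" using interval by simp
  have P0: "\<Psi> ta = mat 1" using PF[OF ta] F0 by simp
  have eq: "Phi t = \<Phi> t" "Psi t = \<Psi> t" if "t \<in> {ta..tb}" for t
    using Z[OF that ta] Z[OF ta that] F0 P0 by (simp_all add: Phi_def Psi_def)
  show "t \<in> {ta..tb} \<Longrightarrow> (Phi has_vector_derivative A_mat D t ** Phi t) (at t within {ta..tb})"
    using F eq by (auto intro: has_vector_derivative_transform)
  show "t \<in> {ta..tb} \<Longrightarrow> (Psi has_vector_derivative - (Psi t ** A_mat D t)) (at t within {ta..tb})"
    using P eq by (auto intro: has_vector_derivative_transform)
  show "t \<in> {ta..tb} \<Longrightarrow> Phi t ** Psi t = mat 1" "t \<in> {ta..tb} \<Longrightarrow> Psi t ** Phi t = mat 1"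
    "\<And>s. t \<in> {ta..tb} \<Longrightarrow> s \<in> {ta..tb} \<Longrightarrow> Z t s = Phi t ** Psi s" "Phi ta = mat 1"
    using eq PF FP Z F0 ta by simp_all
qed

lemma Phi_cont: "continuous_on {ta..tb} Phi"
  unfolding continuous_on_eq_continuous_within
  by (intro ballI has_vector_derivative_continuous[OF Phi_derivative])

lemma Psi_cont: "continuous_on {ta..tb} Psi"
  unfolding continuous_on_eq_continuous_within
  by (intro ballI has_vector_derivative_continuous[OF Psi_derivative])

subsection \<open>Trajectories of sampled-data controls\<close>

text \<open>Keeps the values apart from the control. Entries of \<open>w\<close> from index
  \<open>N\<close> on and values of \<open>u\<close> outside \<open>{ta..<tb}\<close> remain
  free.\<close>

definition sampled_by :: "(real \<Rightarrow> real^'m) \<Rightarrow> (nat \<Rightarrow> real^'m) \<Rightarrow> bool" where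
  "sampled_by u w \<longleftrightarrow> (\<forall>i<N. \<forall>t\<in>{\<sigma> i..<\<sigma> (Suc i)}. u t = w i)"

text \<open>For a solution \<open>q\<close> driven by \<open>u\<close>, this is the derivative of
  \<open>Psi t *v q t\<close>: in that moving frame the homogeneous part of the dynamics
  disappears.\<close>

definition force :: "(real \<Rightarrow> real^'m) \<Rightarrow> real \<Rightarrow> real^'n" where
  "force u t = Psi t *v (B_mat D t *v u t + drift D t)"

text \<open>Variation of constants.\<close>

definition state :: "(real \<Rightarrow> real^'m) \<Rightarrow> real \<Rightarrow> real^'n" where
  "state u t = Phi t *v (q_start D + integral {ta..t} (force u))"

text \<open>In the difference of two solutions the control and the drift cancel. The equation holds
  only almost everywhere, but it integrates by absolute continuity; the resulting integrand is
  continuous, so the difference is differentiable at every point. It solves the homogeneous equation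
  from 0, hence \<open>Psi t *v e t\<close> stays 0.\<close>

lemma trajectory_unique:
  assumes p: "is_trajectory D u p" and q: "is_trajectory D u q"
  shows "p = q"
proof -
  define e where "e t = p t - q t" for t
  define dot where "dot y t = A_mat D t *v y t + B_mat D t *v u t + drift D t" for y t
  have int: "(dot y has_integral (y t - y ta)) {ta..t}" if "is_trajectory D u y" "t \<in> {ta..tb}" for y t
  proof (rule has_integral_abs_continuous_on)
    show "abs_continuous_on ta t y"
      using that by (auto simp: is_trajectory_def intro: abs_continuous_on_subset)
    have "AE r in lebesgue. r \<in> {ta..tb} \<longrightarrow> (y has_vector_derivative dot y r) (at r within {ta..tb})"
      using that(1) by (simp add: is_trajectory_def dot_def)
    then show "AE r in lebesgue. r \<in> {ta..t} \<longrightarrow> (y has_vector_derivative dot y r) (at r within {ta..t})"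
    proof eventually_elim
      case (elim r)
      then show ?case using that(2) by (auto intro: has_vector_derivative_within_subset)
    qed
  qed (use that in auto)
  have cont: "continuous_on {ta..tb} e"
    using p q unfolding e_def is_trajectory_def
    by (intro continuous_intros abs_continuous_on_imp_continuous_on) auto
  have e: "e t = integral {ta..t} (\<lambda>r. A_mat D r *v e r)" if t: "t \<in> {ta..tb}" for t
  proof -
    have "((\<lambda>r. dot p r - dot q r) has_integral ((p t - p ta) - (q t - q ta))) {ta..t}"
      by (intro has_integral_diff int p q t)
    moreover have "p ta = q ta" using p q by (simp add: is_trajectory_def)
    moreover have "dot p r - dot q r = A_mat D r *v e r" for r
      by (simp add: dot_def e_def matrix_vector_mult_diff_distrib)
    ultimately show ?thesis by (simp add: e_def integral_unique)
  qed
  have der: "(e has_vector_derivative A_mat D t *v e t) (at t within {ta..tb})" if t: "t \<in> {ta..tb}" for t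
    by (rule has_vector_derivative_transform[OF t e
          integral_has_vector_derivative[OF continuous_on_matrix_vector_mult[OF A_cont cont] t]])
  have ta: "ta \<in> {ta..tb}" using interval by simp
  have "e t = 0" if t: "t \<in> {ta..tb}" for t
  proof -
    have "Psi t *v e t = Psi ta *v e ta"
      by (rule linear_ode_unique[OF bounded_bilinear_matrix_vector_mult matrix_vector_mul_assoc[symmetric]
            Psi_derivative der ta t])
    also have "e ta = 0" using e[OF ta] by simp
    finally have "Phi t *v (Psi t *v e t) = 0" by simp
    then show ?thesis by (simp add: matrix_vector_mul_assoc Phi_Psi[OF t])
  qed
  then show ?thesis
    using p q by (intro extensionalityI[of _ "{ta..tb}"]) (auto simp: is_trajectory_def e_def)
qed

context
  fixes u w
  assumes uw: "sampled_by u w"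
begin

text \<open>On a piece the control may be replaced by its constant value, which makes the integrand
  continuous. The right endpoint is discarded because at \<open>\<sigma> (Suc i)\<close> the control
  already takes its next value.\<close>

lemma force_piece:
  assumes i: "i < N" and t: "t \<in> samp_interval D i"
  shows "(force u has_integral integral {\<sigma> i..t} (force (\<lambda>_. w i))) {\<sigma> i..t}"
proof (rule has_integral_spike_finite[of "{t}"])
  have sub: "{\<sigma> i..t} \<subseteq> {ta..tb}" using samp_interval_subset[OF i] t by auto
  have "continuous_on {\<sigma> i..t} (force (\<lambda>_. w i))"
    unfolding force_def
    by (intro continuous_intros continuous_on_subset[OF _ sub] Psi_cont B_cont drift_cont)
  then show "(force (\<lambda>_. w i) has_integral integral {\<sigma> i..t} (force (\<lambda>_. w i))) {\<sigma> i..t}"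
    by (intro integrable_integral integrable_continuous_real)
qed (use uw i t in \<open>auto simp: sampled_by_def force_def\<close>)

lemma force_integrable: "force u integrable_on {ta..tb}"
proof -
  have "(force u has_integral (\<Sum>i<N. integral (samp_interval D i) (force (\<lambda>_. w i)))) {\<sigma> 0..\<sigma> N}"
    by (intro has_integral_combine_sum force_piece less_imp_le sample_time_less)
      (auto dest: sample_time_less)
  then show ?thesis unfolding sample_time_0 sample_time_N by blast
qed

lemma state_piece_eq:
  assumes i: "i < N" and t: "t \<in> samp_interval D i"
  shows "state u t = Phi t *v (Psi (\<sigma> i) *v state u (\<sigma> i) + integral {\<sigma> i..t} (force (\<lambda>_. w i)))"
proof -
  have tin: "t \<in> {ta..tb}" and si: "\<sigma> i \<in> {ta..tb}"
    using samp_interval_subset[OF i] t sample_time_in[of i] i by auto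
  have "force u integrable_on {ta..t}"
    by (rule integrable_subinterval_real[OF force_integrable]) (use tin in auto)
  then have "integral {ta..t} (force u) = integral {ta..\<sigma> i} (force u) + integral {\<sigma> i..t} (force u)"
    using Henstock_Kurzweil_Integration.integral_combine[of ta "\<sigma> i" t "force u"] t si by simp
  also have "integral {\<sigma> i..t} (force u) = integral {\<sigma> i..t} (force (\<lambda>_. w i))"
    using force_piece[OF i t] by (rule integral_unique)
  moreover have "Psi (\<sigma> i) *v state u (\<sigma> i) = q_start D + integral {ta..\<sigma> i} (force u)"
    by (simp add: state_def matrix_vector_mul_assoc Psi_Phi[OF si])
  ultimately show ?thesis by (simp add: state_def add.assoc)
qed

text \<open>Variation of constants restarted at \<open>\<sigma> i\<close>. Moving
  \<open>Phi t\<close> inside the integral turns \<open>Psi\<close> into \<open>Z t\<close>, and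
  splitting control from drift produces \<open>beta\<close> and the integral in
  \<open>gamma\<close>.\<close>

lemma state_step:
  assumes i: "i < N" and t: "t \<in> samp_interval D i"
  shows "state u t = Z t (\<sigma> i) *v state u (\<sigma> i) + beta D i t *v w i
    + integral {\<sigma> i..t} (\<lambda>r. Z t r *v drift D r)"
proof -
  have tin: "t \<in> {ta..tb}" and si: "\<sigma> i \<in> {ta..tb}"
    using samp_interval_subset[OF i] t sample_time_in[of i] i by auto
  have sub: "{\<sigma> i..t} \<subseteq> {ta..tb}" using si tin by auto
  note cont = continuous_on_subset[OF _ sub]
  have c1: "(\<lambda>r. Phi t ** Psi r ** B_mat D r) integrable_on {\<sigma> i..t}"
    by (intro integrable_continuous_real continuous_intros cont Psi_cont B_cont)
  have c2: "(\<lambda>r. (Phi t ** Psi r) *v drift D r) integrable_on {\<sigma> i..t}"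
    by (intro integrable_continuous_real continuous_intros cont Psi_cont drift_cont)
  have c3: "force (\<lambda>_. w i) integrable_on {\<sigma> i..t}"
    unfolding force_def
    by (intro integrable_continuous_real continuous_intros cont Psi_cont B_cont drift_cont)
  have c4: "(\<lambda>r. (Phi t ** Psi r ** B_mat D r) *v w i) integrable_on {\<sigma> i..t}"
    by (intro integrable_continuous_real continuous_intros cont Psi_cont B_cont)
  have "Phi t *v integral {\<sigma> i..t} (force (\<lambda>_. w i)) = integral {\<sigma> i..t} (\<lambda>r. Phi t *v force (\<lambda>_. w i) r)"
    using integral_linear[OF c3 matrix_vector_mul_bounded_linear[of "Phi t"]] by (simp add: o_def)
  also have "\<dots> = integral {\<sigma> i..t} (\<lambda>r. (Phi t ** Psi r ** B_mat D r) *v w i + (Phi t ** Psi r) *v drift D r)"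
    by (simp add: force_def matrix_vector_right_distrib matrix_vector_mul_assoc matrix_mul_assoc)
  also have "\<dots> = integral {\<sigma> i..t} (\<lambda>r. (Phi t ** Psi r ** B_mat D r) *v w i)
      + integral {\<sigma> i..t} (\<lambda>r. (Phi t ** Psi r) *v drift D r)"
    by (rule integral_add[OF c4 c2])
  also have "integral {\<sigma> i..t} (\<lambda>r. (Phi t ** Psi r ** B_mat D r) *v w i)
      = integral {\<sigma> i..t} (\<lambda>r. Phi t ** Psi r ** B_mat D r) *v w i"
    using integral_linear[OF c1
        bounded_bilinear.bounded_linear_left[OF bounded_bilinear_matrix_vector_mult, of "w i"]]
    by (simp add: o_def)
  also have "integral {\<sigma> i..t} (\<lambda>r. Phi t ** Psi r ** B_mat D r) = beta D i t"
    unfolding beta_def using sub tin by (intro integral_cong) (auto simp: Ztr_eq)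
  also have "integral {\<sigma> i..t} (\<lambda>r. (Phi t ** Psi r) *v drift D r) = integral {\<sigma> i..t} (\<lambda>r. Z t r *v drift D r)"
    using sub tin by (intro integral_cong) (auto simp: Ztr_eq)
  finally show ?thesis
    unfolding state_piece_eq[OF i t]
    by (simp add: matrix_vector_right_distrib matrix_vector_mul_assoc Ztr_eq[OF tin si])
qed

lemma state_continuous: "continuous_on {ta..tb} (state u)"
  unfolding state_def
  by (intro continuous_intros Phi_cont indefinite_integral_continuous_1 force_integrable)

text \<open>On the piece the frame coordinate of the state is the antiderivative of a continuous
  function, so the product rule with \<open>Phi\<close> gives the equation at every interior
  point.\<close>

lemma state_derivative:
  assumes i: "i < N" and t: "t \<in> {\<sigma> i<..<\<sigma> (Suc i)}"
  shows "(state u has_vector_derivative (A_mat D t *v state u t + B_mat D t *v u t + drift D t)) (at t)"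
proof -
  let ?F = "\<lambda>r. Psi (\<sigma> i) *v state u (\<sigma> i) + integral {\<sigma> i..r} (force (\<lambda>_. w i))"
  have t': "t \<in> samp_interval D i" and tin: "t \<in> {ta..tb}"
    using samp_interval_subset[OF i] t by auto
  have u: "u t = w i" using uw i t by (auto simp: sampled_by_def)
  note cont = continuous_on_subset[OF _ samp_interval_subset[OF i]]
  have "continuous_on (samp_interval D i) (force (\<lambda>_. w i))"
    unfolding force_def by (intro continuous_intros cont Psi_cont B_cont drift_cont)
  from integral_has_vector_derivative[OF this t']
  have "(?F has_vector_derivative force (\<lambda>_. w i) t) (at t within samp_interval D i)"
    by (auto intro!: derivative_eq_intros)
  moreover have "(Phi has_vector_derivative A_mat D t ** Phi t) (at t within samp_interval D i)"
    using Phi_derivative[OF tin] samp_interval_subset[OF i] by (rule has_vector_derivative_within_subset)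
  ultimately have "((\<lambda>r. Phi r *v ?F r) has_vector_derivative
      (Phi t *v force (\<lambda>_. w i) t + (A_mat D t ** Phi t) *v ?F t)) (at t within samp_interval D i)"
    by (intro bounded_bilinear.has_vector_derivative[OF bounded_bilinear_matrix_vector_mult])
  moreover have "Phi t *v force (\<lambda>_. w i) t = B_mat D t *v u t + drift D t"
    by (simp add: force_def matrix_vector_mul_assoc Phi_Psi[OF tin] u)
  moreover have "(A_mat D t ** Phi t) *v ?F t = A_mat D t *v state u t"
    by (simp add: state_piece_eq[OF i t'] matrix_vector_mul_assoc)
  ultimately have "((\<lambda>r. Phi r *v ?F r) has_vector_derivative
      (A_mat D t *v state u t + B_mat D t *v u t + drift D t)) (at t within samp_interval D i)"
    by (simp add: add_ac)
  then have "(state u has_vector_derivative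
      (A_mat D t *v state u t + B_mat D t *v u t + drift D t)) (at t within samp_interval D i)"
    by (rule has_vector_derivative_transform[OF t', rotated]) (rule state_piece_eq[OF i])
  then have "(state u has_vector_derivative
      (A_mat D t *v state u t + B_mat D t *v u t + drift D t)) (at t within {\<sigma> i<..<\<sigma> (Suc i)})"
    by (rule has_vector_derivative_within_subset) auto
  then show ?thesis by (simp only: at_within_open[OF t open_greaterThanLessThan])
qed

lemma open_piece_exists:
  assumes "t \<in> {ta..tb} - \<sigma> ` {..N}"
  obtains i where "i < N" "t \<in> {\<sigma> i<..<\<sigma> (Suc i)}"
proof -
  have "t \<noteq> tb" using assms sample_time_N by (metis DiffD2 atMost_iff imageI order_refl)
  with assms have "t \<in> {ta..<tb}" by auto
  then obtain i where i: "i < N" "t \<in> {\<sigma> i..<\<sigma> (Suc i)}" by (rule sample_piece_exists)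
  moreover have "t \<noteq> \<sigma> i" using assms i by auto
  ultimately show thesis using that by auto
qed

lemma state_is_trajectory: "is_trajectory D u (restrict (state u) {ta..tb})"
proof -
  let ?q = "restrict (state u) {ta..tb}"
  let ?dot = "\<lambda>t. A_mat D t *v ?q t + B_mat D t *v u t + drift D t"
  let ?S = "\<sigma> ` {..N}"
  have der: "(?q has_vector_derivative ?dot t) (at t)" if t: "t \<in> {ta..tb} - ?S" for t
  proof -
    obtain i where i: "i < N" "t \<in> {\<sigma> i<..<\<sigma> (Suc i)}" using t by (rule open_piece_exists)
    have sub: "{\<sigma> i<..<\<sigma> (Suc i)} \<subseteq> {ta..tb}" using samp_interval_subset[OF i(1)] by auto
    have "(?q has_vector_derivative (A_mat D t *v state u t + B_mat D t *v u t + drift D t)) (at t)"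
      by (rule has_vector_derivative_transform_within_open[OF state_derivative[OF i] _ i(2)])
        (use sub in auto)
    then show ?thesis using t by simp
  qed
  have cont: "continuous_on {ta..tb} ?q"
    using continuous_on_cong[OF refl, of "{ta..tb}" ?q "state u"] state_continuous by simp
  \<comment> \<open>Each control value is paired with the whole interval instead of its own piece: a
    finite union of continuous images of a compact set is bounded, which gives the Lipschitz bound
    for the trajectory.\<close>
  define rng where "rng = (\<Union>i<N. (\<lambda>t. A_mat D t *v ?q t + B_mat D t *v w i + drift D t) ` {ta..tb})"
  have "bounded rng"
    unfolding rng_def
    by (intro bounded_UN finite_lessThan ballI compact_imp_bounded compact_continuous_image
        continuous_intros A_cont B_cont drift_cont cont compact_Icc)
  then obtain M where M: "\<And>y. y \<in> rng \<Longrightarrow> norm y \<le> M" by (auto simp: bounded_iff)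
  have "abs_continuous_on ta tb ?q"
  proof (rule abs_continuous_on_bounded_derivative[OF cont, of ?S ?dot M])
    fix t assume "t \<in> {ta<..<tb} - ?S"
    then have t: "t \<in> {ta..tb} - ?S" by auto
    then show "(?q has_vector_derivative ?dot t) (at t)" by (rule der)
    obtain i where i: "i < N" "t \<in> {\<sigma> i<..<\<sigma> (Suc i)}" using t by (rule open_piece_exists)
    then have "u t = w i" using uw by (auto simp: sampled_by_def)
    then have "?dot t \<in> rng" unfolding rng_def
      using i(1) t by (intro UN_I[of i] image_eqI[of _ _ t]) auto
    then show "norm (?dot t) \<le> M" by (rule M)
  qed auto
  moreover have "AE t in lebesgue. t \<in> {ta..tb} \<longrightarrow> (?q has_vector_derivative ?dot t) (at t within {ta..tb})"
  proof -
    have "?S \<in> null_sets lebesgue" 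
      using negligible_finite[of ?S] by (simp add: negligible_iff_null_sets)
    then have "AE t in lebesgue. t \<notin> ?S" by (rule AE_not_in)
    then show ?thesis
    proof eventually_elim
      case (elim t)
      then show ?case using der[of t] by (auto intro: has_vector_derivative_at_within)
    qed
  qed
  moreover have "?q ta = q_start D" using interval by (simp add: state_def Phi_start)
  ultimately show ?thesis by (simp add: is_trajectory_def)
qed

lemma trajectory_eq_state: "t \<in> {ta..tb} \<Longrightarrow> trajectory D u t = state u t"
proof -
  have "trajectory D u = restrict (state u) {ta..tb}"
    unfolding trajectory_def
    by (rule the_equality[where P = "is_trajectory D u", OF state_is_trajectory])
      (rule trajectory_unique[OF _ state_is_trajectory])
  then show "t \<in> {ta..tb} \<Longrightarrow> trajectory D u t = state u t" by simp
qed

end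

section \<open>Discrete dynamics at the sampling times\<close>

lemma n_steps_pos: "0 < N"
  using interval sample_time_0 sample_time_N by (cases N) auto

text \<open>The states at the sampling times, except that the term at index \<open>N\<close> is \<open>q(b) - q\<^sub>b\<close>.\<close>

primrec shifted_state :: "(nat \<Rightarrow> real^'m) \<Rightarrow> nat \<Rightarrow> real^'n" where
  "shifted_state w 0 = q_start D"
| "shifted_state w (Suc i) = Zstep D i *v shifted_state w i + ZB D i *v w i + Z\<Omega> D i"

text \<open>\<open>Z\<Omega>\<close> subtracts the target at its last index only. In the step from
  \<open>i\<close> the previous term is therefore still the true state, and the shift enters exactly
  when \<open>Suc i = N\<close>.\<close>

lemma shifted_state_eq:
  assumes uw: "sampled_by u w" and "i \<le> N"
  shows "shifted_state w i = state u (\<sigma> i) - (if i = N then q_target D else 0)"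
  using \<open>i \<le> N\<close>
proof (induction i)
  case 0
  then show ?case using n_steps_pos by (simp add: sample_time_0 state_def Phi_start)
next
  case (Suc i)
  then have i: "i < N" by simp
  then have "\<sigma> (Suc i) \<in> samp_interval D i" using sample_time_less[OF i] by simp
  from state_step[OF uw i this] Suc show ?case
    by (simp add: ZB_def beta_def Z\<Omega>_def)
qed

lemma Ztr_cont: "s \<in> {ta..tb} \<Longrightarrow> continuous_on {ta..tb} (\<lambda>t. Z t s)"
  by (rule continuous_on_eq[of _ "\<lambda>t. Phi t ** Psi s"])
    (auto intro!: continuous_intros Phi_cont simp: Ztr_eq)

text \<open>The integrand of \<open>beta\<close> depends on the upper limit through
  \<open>Z\<close>. Taking \<open>Phi t\<close> out of the integral leaves an indefinite integral of
  a fixed continuous function.\<close>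

lemma beta_cont:
  assumes i: "i < N"
  shows "continuous_on (samp_interval D i) (beta D i)"
proof (rule continuous_on_eq)
  note sub = samp_interval_subset[OF i]
  note cont = continuous_on_subset[OF _ sub]
  have "(\<lambda>s. Psi s ** B_mat D s) integrable_on samp_interval D i"
    by (intro integrable_continuous_real continuous_intros cont Psi_cont B_cont)
  then have "continuous_on (samp_interval D i) (\<lambda>t. integral {\<sigma> i..t} (\<lambda>s. Psi s ** B_mat D s))"
    by (rule indefinite_integral_continuous_1)
  then show "continuous_on (samp_interval D i) (\<lambda>t. Phi t ** integral {\<sigma> i..t} (\<lambda>s. Psi s ** B_mat D s))"
    by (intro continuous_on_matrix_mult cont[OF Phi_cont])
  fix t assume t: "t \<in> samp_interval D i"
  have sub': "{\<sigma> i..t} \<subseteq> {ta..tb}" using sub t by auto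
  have "(\<lambda>s. Psi s ** B_mat D s) integrable_on {\<sigma> i..t}"
    by (intro integrable_continuous_real continuous_intros continuous_on_subset[OF _ sub'] Psi_cont B_cont)
  from integral_linear[OF this
      bounded_bilinear.bounded_linear_right[OF bounded_bilinear_matrix_matrix_mult, of "Phi t"]]
  have "Phi t ** integral {\<sigma> i..t} (\<lambda>s. Psi s ** B_mat D s) = integral {\<sigma> i..t} (\<lambda>s. Phi t ** (Psi s ** B_mat D s))"
    by (simp add: o_def)
  also have "\<dots> = beta D i t"
    unfolding beta_def using sub sub' t by (intro integral_cong) (auto simp: Ztr_eq matrix_mul_assoc)
  finally show "Phi t ** integral {\<sigma> i..t} (\<lambda>s. Psi s ** B_mat D s) = beta D i t" .
qed

lemma gamma_cont:
  assumes i: "i < N"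
  shows "continuous_on (samp_interval D i) (gamma D i)"
proof (rule continuous_on_eq)
  note sub = samp_interval_subset[OF i]
  note cont = continuous_on_subset[OF _ sub]
  have "(\<lambda>s. Psi s *v drift D s) integrable_on samp_interval D i"
    by (intro integrable_continuous_real continuous_intros cont Psi_cont drift_cont)
  then have "continuous_on (samp_interval D i) (\<lambda>t. integral {\<sigma> i..t} (\<lambda>s. Psi s *v drift D s))"
    by (rule indefinite_integral_continuous_1)
  then show "continuous_on (samp_interval D i)
      (\<lambda>t. Phi t *v integral {\<sigma> i..t} (\<lambda>s. Psi s *v drift D s) - x_ref D t)"
    by (intro continuous_on_diff continuous_on_matrix_vector_mult cont[OF Phi_cont] cont[OF x_cont])
  fix t assume t: "t \<in> samp_interval D i"
  have sub': "{\<sigma> i..t} \<subseteq> {ta..tb}" using sub t by auto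
  have "(\<lambda>s. Psi s *v drift D s) integrable_on {\<sigma> i..t}"
    by (intro integrable_continuous_real continuous_intros continuous_on_subset[OF _ sub'] Psi_cont drift_cont)
  from integral_linear[OF this matrix_vector_mul_bounded_linear[of "Phi t"]]
  have "Phi t *v integral {\<sigma> i..t} (\<lambda>s. Psi s *v drift D s) = integral {\<sigma> i..t} (\<lambda>s. Phi t *v (Psi s *v drift D s))"
    by (simp add: o_def)
  also have "\<dots> = integral {\<sigma> i..t} (\<lambda>s. Z t s *v drift D s)"
    using sub sub' t by (intro integral_cong) (auto simp: Ztr_eq matrix_vector_mul_assoc)
  finally show "Phi t *v integral {\<sigma> i..t} (\<lambda>s. Psi s *v drift D s) - x_ref D t = gamma D i t"
    by (simp add: gamma_def)
qed

subsection \<open>Cost of a sampled-data control\<close>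

definition stage_integrand :: "nat \<Rightarrow> real^'n \<Rightarrow> real^'m \<Rightarrow> real \<Rightarrow> real" where
  "stage_integrand i y c t =
     (W_mat D t *v (Z t (\<sigma> i) *v y + beta D i t *v c + gamma D i t))
       \<bullet> (Z t (\<sigma> i) *v y + beta D i t *v c + gamma D i t)
     + (R_mat D t *v (c - v_ref D t)) \<bullet> (c - v_ref D t)"

definition stage_const :: "nat \<Rightarrow> real" where
  "stage_const i = integral (samp_interval D i) (\<lambda>t. (W_mat D t *v gamma D i t) \<bullet> gamma D i t)
     + integral (samp_interval D i) (\<lambda>t. (R_mat D t *v v_ref D t) \<bullet> v_ref D t)"

text \<open>Twice the running cost on piece \<open>i\<close>, as a polynomial in the initial state
  \<open>y\<close> and the control value \<open>c\<close>; \<open>stage_has_integral\<close>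
  justifies this reading.\<close>

definition stage :: "nat \<Rightarrow> real^'n \<Rightarrow> real^'m \<Rightarrow> real" where
  "stage i y c = (ZWZ D i *v y) \<bullet> y + 2 * ((ZBWZ D i *v y) \<bullet> c) + ((ZBWZB D i + R_int D i) *v c) \<bullet> c
     + 2 * ((ZBWZ\<Omega>X D i - RV D i) \<bullet> c) + 2 * (ZWZ\<Omega>X D i \<bullet> y) + stage_const i"

lemma W_sym: "t \<in> {ta..tb} \<Longrightarrow> transpose (W_mat D t) = W_mat D t"
  using W_psd by (simp add: sym_pos_semidef_def)

lemma R_sym: "t \<in> {ta..tb} \<Longrightarrow> transpose (R_mat D t) = R_mat D t"
  using R_pd by (simp add: sym_pos_def_def)

lemma stage_has_integral:
  assumes i: "i < N"
  shows "(stage_integrand i y c has_integral stage i y c) (samp_interval D i)"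
proof -
  note sub = samp_interval_subset[OF i]
  note cont = continuous_on_subset[OF _ sub]
  have si: "\<sigma> i \<in> {ta..tb}" using i by (intro sample_time_in) simp
  have 1: "((\<lambda>t. (W_mat D t *v (Z t (\<sigma> i) *v y + beta D i t *v c + gamma D i t))
       \<bullet> (Z t (\<sigma> i) *v y + beta D i t *v c + gamma D i t)) has_integral
       (ZWZ D i *v y) \<bullet> y + 2 * ((ZBWZ D i *v y) \<bullet> c) + (ZBWZB D i *v c) \<bullet> c
     + 2 * (ZBWZ\<Omega>X D i \<bullet> c) + 2 * (ZWZ\<Omega>X D i \<bullet> y)
     + integral (samp_interval D i) (\<lambda>t. (W_mat D t *v gamma D i t) \<bullet> gamma D i t)) (samp_interval D i)"
    unfolding ZWZ_def ZBWZ_def ZBWZB_def ZBWZ\<Omega>X_def ZWZ\<Omega>X_def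
    by (rule integral_matrix_quadratic)
      (use sub in \<open>auto intro!: cont W_cont beta_cont gamma_cont Ztr_cont si i W_sym\<close>)
  have RV: "(\<lambda>t. R_mat D t *v v_ref D t) integrable_on samp_interval D i"
    by (intro integrable_continuous_real continuous_intros cont R_cont v_cont)
  \<comment> \<open>The control cost is an instance of the same expansion, with identity matrices,
    zero state and \<open>- v_ref D\<close> as the free term.\<close>
  have "((\<lambda>t. (R_mat D t *v (mat 1 *v 0 + mat 1 *v c + - v_ref D t)) \<bullet> (mat 1 *v (0::real^'m) + mat 1 *v c + - v_ref D t)) has_integral
     (integral (samp_interval D i) (\<lambda>t. transpose (mat 1) ** R_mat D t ** mat 1) *v 0) \<bullet> 0
     + 2 * ((integral (samp_interval D i) (\<lambda>t. transpose (mat 1) ** R_mat D t ** mat 1) *v 0) \<bullet> c)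
     + (integral (samp_interval D i) (\<lambda>t. transpose (mat 1) ** R_mat D t ** mat 1) *v c) \<bullet> c
     + 2 * (integral (samp_interval D i) (\<lambda>t. (transpose (mat 1) ** R_mat D t) *v - v_ref D t) \<bullet> c)
     + 2 * (integral (samp_interval D i) (\<lambda>t. (transpose (mat 1) ** R_mat D t) *v - v_ref D t) \<bullet> 0)
     + integral (samp_interval D i) (\<lambda>t. (R_mat D t *v - v_ref D t) \<bullet> - v_ref D t)) (samp_interval D i)"
    by (rule integral_matrix_quadratic)
      (use sub in \<open>auto intro!: cont R_cont v_cont R_sym continuous_intros\<close>)
  then have 2: "((\<lambda>t. (R_mat D t *v (c - v_ref D t)) \<bullet> (c - v_ref D t)) has_integral
     (R_int D i *v c) \<bullet> c - 2 * (RV D i \<bullet> c)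
     + integral (samp_interval D i) (\<lambda>t. (R_mat D t *v v_ref D t) \<bullet> v_ref D t)) (samp_interval D i)"
    by (simp add: R_int_def RV_def linear_neg[OF matrix_vector_mul_linear] eta_contract_eq)
  show ?thesis
    using has_integral_add[OF 1 2]
    unfolding stage_integrand_def[abs_def] stage_def stage_const_def
    by (simp add: matrix_vector_mult_add_rdistrib inner_add_left inner_diff_left algebra_simps)
qed

lemma cost_eq:
  assumes uw: "sampled_by u w"
  shows "2 * cost D u = (S_mat D *v shifted_state w N) \<bullet> shifted_state w N
    + (\<Sum>i<N. stage i (shifted_state w i) (w i))"
proof -
  let ?q = "trajectory D u"
  let ?L = "\<lambda>t. (W_mat D t *v (?q t - x_ref D t)) \<bullet> (?q t - x_ref D t) +
      (R_mat D t *v (u t - v_ref D t)) \<bullet> (u t - v_ref D t)"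
  have "(?L has_integral stage i (shifted_state w i) (w i)) (samp_interval D i)" if i: "i < N" for i
  proof (rule has_integral_spike_finite[OF _ _ stage_has_integral[OF i]])
    \<comment> \<open>The right endpoint belongs to the next piece, where the control may differ;
      one point does not affect the integral.\<close>
    fix t assume t: "t \<in> samp_interval D i - {\<sigma> (Suc i)}"
    then have t': "t \<in> samp_interval D i" by simp
    have tin: "t \<in> {ta..tb}" using samp_interval_subset[OF i] t' by auto
    have "u t = w i" using uw i t by (auto simp: sampled_by_def)
    moreover have "shifted_state w i = state u (\<sigma> i)"
      using shifted_state_eq[OF uw, of i] i by simp
    then have "?q t - x_ref D t = Z t (\<sigma> i) *v shifted_state w i + beta D i t *v w i + gamma D i t"
      by (simp add: trajectory_eq_state[OF uw tin] state_step[OF uw i t'] gamma_def)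
    ultimately show "?L t = stage_integrand i (shifted_state w i) (w i) t"
      by (simp add: stage_integrand_def)
  qed simp
  then have "(?L has_integral (\<Sum>i<N. stage i (shifted_state w i) (w i))) {\<sigma> 0..\<sigma> N}"
    by (intro has_integral_combine_sum less_imp_le sample_time_less)
  then have "integral {ta..tb} ?L = (\<Sum>i<N. stage i (shifted_state w i) (w i))"
    unfolding sample_time_0 sample_time_N by (rule integral_unique)
  moreover have "?q tb - q_target D = shifted_state w N"
    using shifted_state_eq[OF uw, of N] trajectory_eq_state[OF uw, of tb] interval
    by (simp add: sample_time_N)
  ultimately show ?thesis by (simp add: cost_def Let_def)
qed

subsection \<open>Completion of the square\<close>

text \<open>Strict positivity survives integration because the interval is nondegenerate and the
  integrand is continuous. All strictness of the matrices \<open>T\<close> comes from here.\<close>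

lemma R_int_pd:
  assumes i: "i < N"
  shows "sym_pos_def (R_int D i)"
  unfolding sym_pos_def_def
proof (intro conjI allI impI)
  note sub = samp_interval_subset[OF i]
  note cont = continuous_on_subset[OF _ sub]
  have R: "continuous_on (samp_interval D i) (R_mat D)" by (intro cont R_cont)
  show "transpose (R_int D i) = R_int D i"
    unfolding R_int_def transpose_integral[OF R] using sub by (intro integral_cong) (auto simp: R_sym)
  fix y :: "real^'m" assume y: "y \<noteq> 0"
  have "integral (samp_interval D i) (\<lambda>t. 0) < integral (samp_interval D i) (\<lambda>t. (R_mat D t *v y) \<bullet> y)"
  proof (rule integral_less_real)
    show "{\<sigma> i<..<\<sigma> (Suc i)} \<noteq> {}" using sample_time_less[OF i] by simp
    fix t assume "t \<in> {\<sigma> i<..<\<sigma> (Suc i)}"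
    then have "t \<in> {ta..tb}" using sub by auto
    then show "0 < (R_mat D t *v y) \<bullet> y" using R_pd y by (simp add: sym_pos_def_def)
  qed (intro continuous_intros R)+
  also have "integral (samp_interval D i) (\<lambda>t. (R_mat D t *v y) \<bullet> y) = (R_int D i *v y) \<bullet> y"
    using integral_linear[OF integrable_continuous_real[OF R] bounded_linear_compose[OF bounded_linear_inner_left
          bounded_bilinear.bounded_linear_left[OF bounded_bilinear_matrix_vector_mult]], of y y]
    by (simp add: o_def R_int_def)
  finally show "0 < (R_int D i *v y) \<bullet> y" by simp
qed

lemma ZWZ_sym: "i < N \<Longrightarrow> transpose (ZWZ D i) = ZWZ D i"
  and ZBWZB_sym: "i < N \<Longrightarrow> transpose (ZBWZB D i) = ZBWZB D i"
proof -
  assume i: "i < N"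
  note sub = samp_interval_subset[OF i]
  note cont = continuous_on_subset[OF _ sub]
  have si: "\<sigma> i \<in> {ta..tb}" using i by (intro sample_time_in) simp
  have c1: "continuous_on (samp_interval D i) (\<lambda>t. transpose (Z t (\<sigma> i)) ** W_mat D t ** Z t (\<sigma> i))"
    by (intro continuous_intros cont W_cont Ztr_cont si)
  show "transpose (ZWZ D i) = ZWZ D i"
    unfolding ZWZ_def transpose_integral[OF c1] using sub
    by (intro integral_cong transpose_congruence) (auto simp: W_sym)
  have c2: "continuous_on (samp_interval D i) (\<lambda>t. transpose (beta D i t) ** W_mat D t ** beta D i t)"
    by (intro continuous_intros cont W_cont beta_cont i)
  show "transpose (ZBWZB D i) = ZBWZB D i"
    unfolding ZBWZB_def transpose_integral[OF c2] using sub
    by (intro integral_cong transpose_congruence) (auto simp: W_sym)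
qed

text \<open>This is the state cost with \<open>gamma\<close> set to zero, an integral of values of
  semidefinite forms. The joint form in \<open>y\<close> and \<open>c\<close> is needed for the
  Riccati step; \<open>y = 0\<close> gives the part that enters \<open>T_of\<close>.\<close>

lemma stage_quadratic_nonneg:
  assumes i: "i < N"
  shows "0 \<le> (ZWZ D i *v y) \<bullet> y + 2 * ((ZBWZ D i *v y) \<bullet> c) + (ZBWZB D i *v c) \<bullet> c"
proof -
  note sub = samp_interval_subset[OF i]
  note cont = continuous_on_subset[OF _ sub]
  have si: "\<sigma> i \<in> {ta..tb}" using i by (intro sample_time_in) simp
  have "((\<lambda>t. (W_mat D t *v (Z t (\<sigma> i) *v y + beta D i t *v c + 0)) \<bullet> (Z t (\<sigma> i) *v y + beta D i t *v c + 0))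
     has_integral (ZWZ D i *v y) \<bullet> y + 2 * ((ZBWZ D i *v y) \<bullet> c) + (ZBWZB D i *v c) \<bullet> c
     + 2 * (integral (samp_interval D i) (\<lambda>t. (transpose (beta D i t) ** W_mat D t) *v 0) \<bullet> c)
     + 2 * (integral (samp_interval D i) (\<lambda>t. (transpose (Z t (\<sigma> i)) ** W_mat D t) *v 0) \<bullet> y)
     + integral (samp_interval D i) (\<lambda>t. (W_mat D t *v 0) \<bullet> 0)) (samp_interval D i)"
    unfolding ZWZ_def ZBWZ_def ZBWZB_def
    by (rule integral_matrix_quadratic)
      (use sub in \<open>auto intro!: cont W_cont beta_cont Ztr_cont si i W_sym\<close>)
  then have "((\<lambda>t. (W_mat D t *v (Z t (\<sigma> i) *v y + beta D i t *v c)) \<bullet> (Z t (\<sigma> i) *v y + beta D i t *v c))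
     has_integral (ZWZ D i *v y) \<bullet> y + 2 * ((ZBWZ D i *v y) \<bullet> c) + (ZBWZB D i *v c) \<bullet> c) (samp_interval D i)"
    by simp
  then show ?thesis
    by (rule has_integral_nonneg) (use sub W_psd in \<open>auto simp: sym_pos_semidef_def\<close>)
qed

lemma T_of_pd:
  assumes K: "sym_pos_semidef K'" and i: "i < N"
  shows "sym_pos_def (T_of D K' i)"
  unfolding sym_pos_def_def
proof (intro conjI allI impI)
  show "transpose (T_of D K' i) = T_of D K' i"
    using K R_int_pd[OF i] unfolding T_of_def sym_pos_semidef_def sym_pos_def_def
    by (simp add: transpose_add transpose_congruence ZBWZB_sym[OF i])
  fix y :: "real^'m" assume y: "y \<noteq> 0"
  have "0 \<le> ((transpose (ZB D i) ** K' ** ZB D i) *v y) \<bullet> y"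
    using K unfolding sym_pos_semidef_def
    by (simp add: matrix_vector_mul_assoc[symmetric] inner_transpose_matrix del: transpose_matrix_vector)
  moreover have "0 \<le> (ZBWZB D i *v y) \<bullet> y" using stage_quadratic_nonneg[OF i, of 0 y] by simp
  moreover have "0 < (R_int D i *v y) \<bullet> y" using R_int_pd[OF i] y by (simp add: sym_pos_def_def)
  ultimately show "0 < (T_of D K' i *v y) \<bullet> y"
    by (simp add: T_of_def matrix_vector_mult_add_rdistrib inner_add_left)
qed

text \<open>The new matrix is the partial minimum of a nonnegative quadratic form.\<close>

lemma riccati_step_psd:
  assumes K: "sym_pos_semidef K'" and i: "i < N"
  shows "sym_pos_semidef (Q_of D K' i - transpose (P_of D K' i) ** matrix_inv (T_of D K' i) ** P_of D K' i)"
  unfolding sym_pos_semidef_def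
proof (intro conjI allI)
  let ?T = "T_of D K' i" and ?P = "P_of D K' i" and ?Q = "Q_of D K' i"
  have symK: "transpose K' = K'" using K by (simp add: sym_pos_semidef_def)
  have T: "transpose ?T = ?T" "invertible ?T"
    using T_of_pd[OF K i] sym_pos_def_invertible by (auto simp: sym_pos_def_def)
  show "transpose (?Q - transpose ?P ** matrix_inv ?T ** ?P) = ?Q - transpose ?P ** matrix_inv ?T ** ?P"
    by (simp add: transpose_diff transpose_congruence transpose_matrix_inv T Q_of_def transpose_add
        symK ZWZ_sym[OF i])
  fix y
  \<comment> \<open>The minimizing control value when \<open>H\<close> and \<open>G\<close> vanish,
    so completing the square leaves no gap and no constant. The \<open>+ 0\<close> matches the form
    of \<open>completing_square\<close>.\<close>
  define c where "c = - (matrix_inv ?T *v (?P *v y + 0))"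
  have "((?Q - transpose ?P ** matrix_inv ?T ** ?P) *v y) \<bullet> y
      = (?Q *v y) \<bullet> y + 2 * ((?P *v y) \<bullet> c) + (?T *v c) \<bullet> c"
    using completing_square[OF T, where x = y and H = 0 and w = c and P = ?P and Q = ?Q and G = 0]
    by (simp add: c_def)
  also have "\<dots> = (K' *v (Zstep D i *v y + ZB D i *v c + 0)) \<bullet> (Zstep D i *v y + ZB D i *v c + 0)
      + ((ZWZ D i *v y) \<bullet> y + 2 * ((ZBWZ D i *v y) \<bullet> c) + (ZBWZB D i *v c) \<bullet> c) + (R_int D i *v c) \<bullet> c"
    using quadratic_substitution[OF symK, where \<omega> = 0 and J = 0 and Z = "Zstep D i" and B = "ZB D i" and x = y and w = c]
    by (simp add: Q_of_def P_of_def T_of_def matrix_vector_mult_add_rdistrib inner_add_left)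
  also have "\<dots> \<ge> 0"
  proof (rule add_nonneg_nonneg[OF add_nonneg_nonneg[OF _ stage_quadratic_nonneg[OF i]]])
    show "0 \<le> (R_int D i *v c) \<bullet> c"
      using R_int_pd[OF i] by (cases "c = 0") (auto simp: sym_pos_def_def intro: less_imp_le)
  qed (use K in \<open>simp add: sym_pos_semidef_def\<close>)
  finally show "0 \<le> ((?Q - transpose ?P ** matrix_inv ?T ** ?P) *v y) \<bullet> y" .
qed

section \<open>Backward recursion and exact decomposition of the cost\<close>

lemma K_seq_N: "K_seq D N = S_mat D" and J_seq_N: "J_seq D N = 0"
  by (simp_all add: K_seq.simps J_seq.simps)

lemma K_seq_step: "i < N \<Longrightarrow> K_seq D i =
    Q_of D (K_seq D (Suc i)) i - transpose (P_seq D i) ** matrix_inv (T_seq D i) ** P_seq D i"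
  by (subst K_seq.simps) (simp add: Let_def P_seq_def T_seq_def)

lemma J_seq_step: "i < N \<Longrightarrow> J_seq D i =
    G_of D (K_seq D (Suc i)) (J_seq D (Suc i)) i
    - (transpose (P_seq D i) ** matrix_inv (T_seq D i)) *v H_seq D i"
  by (subst J_seq.simps) (simp add: Let_def P_seq_def T_seq_def H_seq_def)

lemma K_seq_psd: "i \<le> N \<Longrightarrow> sym_pos_semidef (K_seq D i)"
proof (induction i rule: inc_induct)
  case base
  then show ?case by (simp add: K_seq_N S_psd)
next
  case (step i)
  then show ?case
    using riccati_step_psd[OF step.IH] by (simp add: K_seq_step P_seq_def T_seq_def)
qed

lemma T_seq_pd: "i < N \<Longrightarrow> sym_pos_def (T_seq D i)"
  unfolding T_seq_def by (intro T_of_pd K_seq_psd) auto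

definition val :: "nat \<Rightarrow> real^'n \<Rightarrow> real" where
  "val i y = (K_seq D i *v y) \<bullet> y + 2 * (J_seq D i \<bullet> y)"

definition feedback :: "nat \<Rightarrow> real^'n \<Rightarrow> real^'m" where
  "feedback i y = - (matrix_inv (T_seq D i) *v (P_seq D i *v y + H_seq D i))"

text \<open>The feedback law is evaluated at the state produced by \<open>w\<close> itself, not at
  the optimal one.\<close>

definition gap :: "(nat \<Rightarrow> real^'m) \<Rightarrow> nat \<Rightarrow> real" where
  "gap w i = (let d = w i - feedback i (shifted_state w i) in (T_seq D i *v d) \<bullet> d)"

text \<open>Everything free of state and control: the next value function at the drift term, the
  constant of the running cost, and the remainder left by completing the square.\<close>

definition step_const :: "nat \<Rightarrow> real" where
  "step_const i = (K_seq D (Suc i) *v Z\<Omega> D i) \<bullet> Z\<Omega> D i + 2 * (J_seq D (Suc i) \<bullet> Z\<Omega> D i)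
     + stage_const i - (matrix_inv (T_seq D i) *v H_seq D i) \<bullet> H_seq D i"

text \<open>Dynamic programming as an identity valid for every control: the minimum over the control
  value is replaced by the explicit excess \<open>gap w i\<close>.\<close>

lemma bellman_step:
  assumes i: "i < N"
  shows "val (Suc i) (shifted_state w (Suc i)) + stage i (shifted_state w i) (w i)
    = val i (shifted_state w i) + gap w i + step_const i"
proof -
  let ?y = "shifted_state w i" and ?c = "w i"
  let ?K = "K_seq D (Suc i)" and ?J = "J_seq D (Suc i)"
  have symK: "transpose ?K = ?K" using K_seq_psd[of "Suc i"] i by (simp add: sym_pos_semidef_def)
  have T: "transpose (T_seq D i) = T_seq D i" "invertible (T_seq D i)"
    using T_seq_pd[OF i] sym_pos_def_invertible by (auto simp: sym_pos_def_def)
  have "val (Suc i) (shifted_state w (Suc i)) + stage i ?y ?c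
    = (Q_of D ?K i *v ?y) \<bullet> ?y + 2 * ((P_seq D i *v ?y) \<bullet> ?c) + (T_seq D i *v ?c) \<bullet> ?c
      + 2 * (H_seq D i \<bullet> ?c) + 2 * (G_of D ?K ?J i \<bullet> ?y)
      + ((?K *v Z\<Omega> D i) \<bullet> Z\<Omega> D i + 2 * (?J \<bullet> Z\<Omega> D i) + stage_const i)"
    unfolding val_def shifted_state.simps quadratic_substitution[OF symK] stage_def
    by (simp add: Q_of_def P_seq_def P_of_def T_seq_def T_of_def H_seq_def H_of_def G_of_def
        matrix_vector_mult_add_rdistrib inner_add_left inner_diff_left algebra_simps
        del: transpose_matrix_vector)
  also have "\<dots> = val i ?y + gap w i + step_const i"
    unfolding completing_square[OF T] val_def gap_def step_const_def feedback_def
    by (simp add: K_seq_step[OF i] J_seq_step[OF i] Let_def)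
  finally show ?thesis .
qed

text \<open>Telescoping of \<open>bellman_step\<close>. At index \<open>N\<close> the value function
  is the terminal cost, since \<open>K_seq D N = S_mat D\<close>, \<open>J_seq D N = 0\<close> and
  the last shifted state has the target subtracted.\<close>

lemma cost_decomposition:
  assumes uw: "sampled_by u w"
  shows "2 * cost D u = val 0 (q_start D) + (\<Sum>i<N. step_const i) + (\<Sum>i<N. gap w i)"
proof -
  have "val k (shifted_state w k) + (\<Sum>i<k. stage i (shifted_state w i) (w i))
    = val 0 (q_start D) + (\<Sum>i<k. step_const i) + (\<Sum>i<k. gap w i)" if "k \<le> N" for k
    using that
  proof (induction k)
    case (Suc k)
    then show ?case using bellman_step[of k w] by (simp del: shifted_state.simps)
  qed simp
  from this[of N] show ?thesis by (simp add: cost_eq[OF uw] val_def K_seq_N J_seq_N)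
qed

lemma gap_nonneg: "i < N \<Longrightarrow> 0 \<le> gap w i"
  using T_seq_pd[of i] unfolding sym_pos_def_def gap_def Let_def
  by (cases "w i = feedback i (shifted_state w i)") (auto intro: less_imp_le)

lemma gap_eq_0: "i < N \<Longrightarrow> gap w i = 0 \<longleftrightarrow> w i = feedback i (shifted_state w i)"
  using T_seq_pd[of i] unfolding sym_pos_def_def gap_def Let_def
  by (metis eq_iff_diff_eq_0 inner_zero_right less_irrefl)

section \<open>The optimal control as the unique minimizer\<close>

lemma sampled_controls_iff:
  "u \<in> sampled_controls D \<longleftrightarrow> u \<in> extensional {ta..<tb} \<and> (\<exists>w. sampled_by u w)"
  unfolding sampled_controls_def sampled_by_def by (auto simp: choice_iff')

lemma sampled_by_unique:
  assumes "sampled_by u w" "sampled_by u' w'" "u \<in> extensional {ta..<tb}" "u' \<in> extensional {ta..<tb}"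
    and eq: "\<And>i. i < N \<Longrightarrow> w i = w' i"
  shows "u = u'"
proof (rule extensionalityI)
  fix t assume "t \<in> {ta..<tb}"
  then obtain i where "i < N" "t \<in> {\<sigma> i..<\<sigma> (Suc i)}" by (rule sample_piece_exists)
  then show "u t = u' t" using assms by (simp add: sampled_by_def)
qed (use assms in auto)

lemma sampled_by_exists: "\<exists>u. u \<in> extensional {ta..<tb} \<and> sampled_by u w"
proof -
  define u where "u = restrict (\<lambda>t. w (THE i. i < N \<and> t \<in> {\<sigma> i..<\<sigma> (Suc i)})) {ta..<tb}"
  \<comment> \<open>Half-open pieces do not overlap, so the index selected by the description is the
    given one.\<close>
  have "u t = w i" if i: "i < N" and t: "t \<in> {\<sigma> i..<\<sigma> (Suc i)}" for i t
  proof -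
    have "(THE i. i < N \<and> t \<in> {\<sigma> i..<\<sigma> (Suc i)}) = i"
      by (rule the_equality) (use i t sample_piece_unique in blast)+
    moreover have "t \<in> {ta..<tb}"
      using t samp_interval_subset[OF i] sample_time_in[of "Suc i"] i by auto
    ultimately show ?thesis by (simp add: u_def)
  qed
  then show ?thesis by (intro exI[of _ u]) (auto simp: sampled_by_def u_def)
qed

text \<open>A control obeying the feedback law has zero gaps and attains the lower bound of the
  decomposition; conversely any minimizer has zero gaps.\<close>

lemma optimal_sampled_control_eq:
  assumes w: "\<And>i. i < N \<Longrightarrow> w i = feedback i (shifted_state w i)"
  shows "sampled_by (optimal_sampled_control D) w"
proof -
  obtain u where u: "u \<in> extensional {ta..<tb}" "sampled_by u w" using sampled_by_exists by blast
  have "gap w i = 0" if "i < N" for i using gap_eq_0[OF that] w[OF that] by blast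
  then have min: "2 * cost D u = val 0 (q_start D) + (\<Sum>i<N. step_const i)"
    using cost_decomposition[OF u(2)] by simp
  have "optimal_sampled_control D = u"
    unfolding optimal_sampled_control_def
  proof (rule the_equality)
    have "cost D u \<le> cost D u'" if "u' \<in> sampled_controls D" for u'
    proof -
      obtain w' where "sampled_by u' w'" using \<open>u' \<in> _\<close> by (auto simp: sampled_controls_iff)
      from cost_decomposition[OF this] min sum_nonneg[of "{..<N}" "gap w'"] gap_nonneg
      show ?thesis by simp
    qed
    then show "u \<in> sampled_controls D \<and> (\<forall>w\<in>sampled_controls D. cost D u \<le> cost D w)"
      using u by (auto simp: sampled_controls_iff)
  next
    fix u' assume u': "u' \<in> sampled_controls D \<and> (\<forall>w\<in>sampled_controls D. cost D u' \<le> cost D w)"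
    then obtain w' where w': "u' \<in> extensional {ta..<tb}" "sampled_by u' w'"
      by (auto simp: sampled_controls_iff)
    have "cost D u' \<le> cost D u" using u u' by (auto simp: sampled_controls_iff)
    with cost_decomposition[OF w'(2)] min have "(\<Sum>i<N. gap w' i) \<le> 0" by simp
    then have "(\<Sum>i<N. gap w' i) = 0"
      using sum_nonneg[of "{..<N}" "gap w'"] gap_nonneg by (simp add: antisym)
    then have gap0: "gap w' i = 0" if "i < N" for i
      using that gap_nonneg sum_nonneg_eq_0_iff[of "{..<N}" "gap w'"] by auto
    \<comment> \<open>A zero gap relates \<open>w' i\<close> to the state of \<open>w'\<close>, so
      control values can be compared only together with states, forward from the common initial
      state.\<close>
    have st: "shifted_state w' i = shifted_state w i" if "i \<le> N" for i
      using that
    proof (induction i)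
      case (Suc i)
      then have "w' i = w i" using gap0[of i] gap_eq_0[of i w'] w[of i] by simp
      then show ?case using Suc by simp
    qed simp
    have "w' i = w i" if "i < N" for i
      using gap0[OF that] gap_eq_0[OF that, of w'] w[OF that] st[of i] that by simp
    then show "u' = u" by (intro sampled_by_unique[OF w'(2) u(2) w'(1) u(1)])
  qed
  with u show ?thesis by simp
qed

end

theorem corollary1:
  fixes D :: "('n::finite, 'm::finite) lq_data"
    and q :: "nat \<Rightarrow> real^'n"
    and U :: "nat \<Rightarrow> real^'m"
  assumes "t_start D < t_end D"
    and "sym_pos_semidef (S_mat D)"
    and "continuous_on {t_start D..t_end D} (x_ref D)"
    and "continuous_on {t_start D..t_end D} (drift D)"
    and "continuous_on {t_start D..t_end D} (v_ref D)"
    and "continuous_on {t_start D..t_end D} (A_mat D)"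
    and "continuous_on {t_start D..t_end D} (B_mat D)"
    and "continuous_on {t_start D..t_end D} (W_mat D)"
    and "continuous_on {t_start D..t_end D} (R_mat D)"
    and "\<And>t. t \<in> {t_start D..t_end D} \<Longrightarrow> sym_pos_semidef (W_mat D t)"
    and "\<And>t. t \<in> {t_start D..t_end D} \<Longrightarrow> sym_pos_def (R_mat D t)"
    and "n_steps D \<ge> 1"
    and "\<And>i. i < n_steps D \<Longrightarrow> 0 < step D i"
    and "(\<Sum>i<n_steps D. step D i) = t_end D - t_start D"
    and "q 0 = q_start D"
    and "\<And>i. i < n_steps D \<Longrightarrow>
           U i = - (matrix_inv (T_seq D i) *v (P_seq D i *v q i + H_seq D i))"
    and "\<And>i. i < n_steps D \<Longrightarrow>
           q (Suc i) = Ztr D (sample_time D (Suc i)) (sample_time D i) *v q i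
             + ZB D i *v U i + Z\<Omega> D i"
  shows "\<forall>i<n_steps D. \<forall>t\<in>{sample_time D i..<sample_time D (Suc i)}.
           optimal_sampled_control D t = U i"
proof -
  interpret lq_problem D by unfold_locales fact+
  \<comment> \<open>Both sequences obey one recursion, assumed for \<open>q\<close> only below
    \<open>N\<close>; its last term is the final state minus the target.\<close>
  have q: "q i = shifted_state U i" if "i \<le> N" for i
    using that by (induction i) (simp_all add: assms(15,17))
  have "U i = feedback i (shifted_state U i)" if "i < N" for i
    using assms(16)[OF that] q[of i] that by (simp add: feedback_def)
  then have "sampled_by (optimal_sampled_control D) U" by (rule optimal_sampled_control_eq)
  then show ?thesis by (simp add: sampled_by_def)
qed

end
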